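(* Let $1 < \alpha < 2$, $1/\alpha + 1/\alpha' = 1$ and $p \geq \alpha'$. Then for every analytic function $F$ on $\mathbb D$ with $F(0) = 0$ we have $$ \| F \|_{A^p_0}^p \asymp \inf_{\omega \in S_2} \left( \int_{\mathbb D} |F'(z)|^\alpha \omega^\alpha (z)\, dm(z) \right)^{1/\alpha},$$ where $S_2 = S_2(F)$ is the set of measurable functions $\omega$ on $\mathbb D$ given by $$S_2 = \left\{ \omega \geq 0 : \int_{\mathbb D} |F'(z)|^{(p-1)\alpha'} \omega^{-\alpha'}(z)(1-|z|)^{p\alpha'}\, dm(z) \leq 1 \right\}.$$
   Context: $\mathbb D = \{z \in \mathbb C : |z|<1\}$ is the unit disc and $dm$ is area measure on $\mathbb D$. $A^p_0 = \{F \in A^p : F(0)=0\}$ where $A^p$ is the (unweighted) Bergman space on $\mathbb D$, and $\|F\|_{A^p_0}^p = \int_{\mathbb D} |F(z)|^p\, dm(z) \in [0,\infty]$ for $F$ analytic on $\mathbb D$ with $F(0)=0$. The notation $X \asymp Y$ means that there are constants $0 < c \leq C < \infty$, depending only on $p$ and $\alpha$ (not on $F$), with $cX \leq Y \leq CX$; values $+\infty$ are allowed, so one side is infinite if and only if the other is. Conventions: $\omega^{-\alpha'} = +\infty$ where $\omega = 0$, $0\cdot\infty = 0$, and $\inf\emptyset = +\infty$. *)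

theory Defs
  imports "HOL-Complex_Analysis.Complex_Analysis"
begin

abbreviation unit_disc :: "complex set" where
  "unit_disc \<equiv> ball 0 1"

(* Unnormalised planar area measure on the disc, on the Lebesgue measurable subsets. *)
abbreviation area_disc :: "complex measure" where
  "area_disc \<equiv> lebesgue_on unit_disc"

(* Powers with real exponent on [0,\<infinity>], extending powr on the positive reals by
   0^a = \<infinity> and \<infinity>^a = 0 for a < 0, \<infinity>^a = \<infinity> for a > 0, and x^0 = 1.
   (The real powr has 0 powr a = 0 for every a, so it cannot be used for \<omega>^(-\<alpha>').)
   Multiplication on ennreal satisfies 0 * \<infinity> = 0. *)
definition epowr :: "ennreal \<Rightarrow> real \<Rightarrow> ennreal" (infixr \<open>epowr\<close> 80) where
  "x epowr a =
    (if a = 0 then 1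
     else if x = 0 then (if a < 0 then \<infinity> else 0)
     else if x = \<infinity> then (if a < 0 then 0 else \<infinity>)
     else ennreal (enn2real x powr a))"

(* The p-th power of the A^p norm; for holomorphic F and p > 0 it is \<infinity> exactly when F is not in A^p. *)
definition bergman_norm_pow :: "real \<Rightarrow> (complex \<Rightarrow> complex) \<Rightarrow> ennreal" where
  "bergman_norm_pow p F = (\<integral>\<^sup>+z. ennreal (norm (F z)) epowr p \<partial>area_disc)"

(* q is the exponent conjugate to \<alpha>. Weights are finite-valued; only their
   values on the disc matter. *)
definition S2 :: "real \<Rightarrow> real \<Rightarrow> (complex \<Rightarrow> complex) \<Rightarrow> (complex \<Rightarrow> real) set" where
  "S2 p q F = {\<omega>. \<omega> \<in> borel_measurable area_disc \<and> (\<forall>z\<in>unit_disc. 0 \<le> \<omega> z) \<and>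
     (\<integral>\<^sup>+z. ennreal (norm (deriv F z)) epowr ((p - 1) * q) * ennreal (\<omega> z) epowr (- q)
            * ennreal (1 - norm z) epowr (p * q) \<partial>area_disc) \<le> 1}"

end

theory Submission
  imports Defs
begin

text \<open>
  Two independent facts combine. The first is pure measure theory: by Hoelder's inequality and its
  case of equality, the infimum over the weights in \<open>S2\<close> is equal to the integral \<open>N\<close> of
  \<open>norm (deriv F z) powr p * (1 - norm z) powr p\<close> over the disc. This is
  \<open>INF_weights_eq_nn_integral\<close>, and it holds with value infinity as well.

  The second is the Littlewood--Paley description of the Bergman norm: for \<open>F 0 = 0\<close> the integral \<open>N\<close> is
  comparable to the integral of \<open>norm (F z) powr p\<close>. The bound of \<open>N\<close> by the norm
  (\<open>bergman_derivative_upper\<close>) is local: the Cauchy estimate controls the derivative at \<open>z\<close> by the mean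
  of \<open>F\<close> over a disc of radius proportional to \<open>1 - norm z\<close>, and such discs overlap boundedly.
  The converse (\<open>bergman_derivative_lower\<close>) is a Hardy inequality along radii: \<open>F z - F (z / 2)\<close> is an
  integral of the derivative over the outer half of the radius, Hoelder's inequality with a
  suitable power weight makes the resulting double integral converge, and the value \<open>F (z / 2)\<close>
  is estimated directly by the mean value inequality for the derivative. All
  inequalities hold for integrals with values in \<open>[0, \<infinity>]\<close>, which covers the functions outside the
  Bergman space.

  The mean value inequalities over discs are obtained from the Cauchy formula on circles by averaging
  over rotations, which preserve area, instead of through polar coordinates.
\<close>

section \<open>Hoelder's inequality and optimal weights\<close>

lemma epowr_of_pos: "0 < x \<Longrightarrow> ennreal x epowr a = ennreal (x powr a)"
  by (auto simp: epowr_def)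

lemma epowr_of_nonneg: "0 \<le> x \<Longrightarrow> 0 < a \<Longrightarrow> ennreal x epowr a = ennreal (x powr a)"
  by (cases "x = 0") (auto simp: epowr_def)

text \<open>Young's inequality, applied to \<open>f\<close> and \<open>g\<close> divided by \<open>A powr (1 / a)\<close> and \<open>B powr (1 / b)\<close>
  and then integrated. The bounds \<open>A\<close> and \<open>B\<close> are real so that no power of an infinite
  integral has to be formed; when one of them vanishes, so does the product almost everywhere.\<close>

lemma nn_integral_Holder:
  fixes f g :: "'a \<Rightarrow> real"
  assumes a: "1 < a" "1 < b" "1 / a + 1 / b = 1"
    and [measurable]: "f \<in> borel_measurable M" "g \<in> borel_measurable M"
    and f0: "\<And>x. x \<in> space M \<Longrightarrow> 0 \<le> f x" and g0: "\<And>x. x \<in> space M \<Longrightarrow> 0 \<le> g x"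
    and A: "0 \<le> A" "(\<integral>\<^sup>+x. ennreal (f x powr a) \<partial>M) \<le> ennreal A"
    and B: "0 \<le> B" "(\<integral>\<^sup>+x. ennreal (g x powr b) \<partial>M) \<le> ennreal B"
  shows "(\<integral>\<^sup>+x. ennreal (f x * g x) \<partial>M) \<le> ennreal (A powr (1 / a) * B powr (1 / b))"
proof -
  consider "A = 0" | "B = 0" | "0 < A" "0 < B"
    using A(1) B(1) by fastforce
  then show ?thesis
  proof cases
    case 1
    then have "(\<integral>\<^sup>+x. ennreal (f x powr a) \<partial>M) = 0" using A by simp
    then have "AE x in M. ennreal (f x powr a) = 0"
      by (subst (asm) nn_integral_0_iff_AE) auto
    then have "AE x in M. ennreal (f x * g x) = 0" by eventually_elim (simp add: ennreal_eq_0_iff)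
    then have "(\<integral>\<^sup>+x. ennreal (f x * g x) \<partial>M) = 0"
      by (subst nn_integral_0_iff_AE) auto
    then show ?thesis by simp
  next
    case 2
    then have "(\<integral>\<^sup>+x. ennreal (g x powr b) \<partial>M) = 0" using B by simp
    then have "AE x in M. ennreal (g x powr b) = 0"
      by (subst (asm) nn_integral_0_iff_AE) auto
    then have "AE x in M. ennreal (f x * g x) = 0" by eventually_elim (simp add: ennreal_eq_0_iff)
    then have "(\<integral>\<^sup>+x. ennreal (f x * g x) \<partial>M) = 0"
      by (subst nn_integral_0_iff_AE) auto
    then show ?thesis by simp
  next
    case 3
    define c where "c = A powr (1 / a) * B powr (1 / b)"
    have "0 < c" using 3 by (simp add: c_def)
    have young: "f x * g x \<le> c * (f x powr a / (a * A) + g x powr b / (b * B))"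
      if x: "x \<in> space M" for x
    proof -
      have "(f x / A powr (1 / a)) * (g x / B powr (1 / b))
          \<le> (f x / A powr (1 / a)) powr a / a + (g x / B powr (1 / b)) powr b / b"
        using a f0[OF x] g0[OF x] by (intro Youngs_inequality) auto
      also have "\<dots> = f x powr a / (a * A) + g x powr b / (b * B)"
        using a f0[OF x] g0[OF x] 3 by (simp add: powr_divide powr_powr mult.commute)
      finally show ?thesis using 3 by (simp add: c_def field_simps)
    qed
    have "(\<integral>\<^sup>+x. ennreal (f x * g x) \<partial>M)
        \<le> (\<integral>\<^sup>+x. ennreal (c / (a * A)) * ennreal (f x powr a) + ennreal (c / (b * B)) * ennreal (g x powr b) \<partial>M)"
      using young a 3 \<open>0 < c\<close>
      by (intro nn_integral_mono) (auto simp flip: ennreal_mult' ennreal_plus simp: distrib_left)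
    also have "\<dots> = ennreal (c / (a * A)) * (\<integral>\<^sup>+x. ennreal (f x powr a) \<partial>M)
        + ennreal (c / (b * B)) * (\<integral>\<^sup>+x. ennreal (g x powr b) \<partial>M)"
      by (subst nn_integral_add) (auto simp: nn_integral_cmult)
    also have "\<dots> \<le> ennreal (c / (a * A)) * ennreal A + ennreal (c / (b * B)) * ennreal B"
      by (intro add_mono mult_left_mono A B) auto
    also have "\<dots> = ennreal (c / (a * A) * A + c / (b * B) * B)"
      using a 3 \<open>0 < c\<close> by (simp flip: ennreal_mult' ennreal_plus)
    also have "c / (a * A) * A + c / (b * B) * B = c * (1 / a + 1 / b)"
      using 3 by (simp add: distrib_left)
    finally show ?thesis using a by (simp add: c_def)
  qed
qed

text \<open>The form in which the inequality is used on circles and on radii: there \<open>y\<close> is a difference or a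
  derivative, \<open>f * g\<close> an integrand that dominates it, and \<open>g\<close> an explicit weight. Because \<open>B\<close> is
  positive, an infinite integral on the right makes the claim trivial.\<close>

lemma powr_le_nn_integral_Holder:
  fixes f g :: "'a \<Rightarrow> real"
  assumes p: "1 < p"
    and [measurable]: "f \<in> borel_measurable M" "g \<in> borel_measurable M"
    and f0: "\<And>x. x \<in> space M \<Longrightarrow> 0 \<le> f x" and g0: "\<And>x. x \<in> space M \<Longrightarrow> 0 \<le> g x"
    and B: "0 < B" "(\<integral>\<^sup>+x. ennreal (g x powr (p / (p - 1))) \<partial>M) \<le> ennreal B"
    and y: "0 \<le> y" "ennreal y \<le> (\<integral>\<^sup>+x. ennreal (f x * g x) \<partial>M)"
  shows "ennreal (y powr p) \<le> ennreal (B powr (p - 1)) * (\<integral>\<^sup>+x. ennreal (f x powr p) \<partial>M)"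
proof (cases "(\<integral>\<^sup>+x. ennreal (f x powr p) \<partial>M)")
  case (real A)
  have "ennreal y \<le> ennreal (A powr (1 / p) * B powr (1 / (p / (p - 1))))"
    using p real B f0 g0 
    by (intro order.trans[OF y(2)] nn_integral_Holder) (auto simp: field_simps)
  then have "y \<le> A powr (1 / p) * B powr (1 / (p / (p - 1)))"
    by (simp add: ennreal_le_iff)
  then have "y powr p \<le> (A powr (1 / p) * B powr (1 / (p / (p - 1)))) powr p"
    using p y by (intro powr_mono2) auto
  also have "\<dots> = B powr (p - 1) * A"
    using p real(1) by (simp add: powr_mult powr_powr mult.commute)
  finally show ?thesis
    using real by (simp flip: ennreal_mult')
next
  case top
  then show ?thesis using B by (simp add: ennreal_mult_top)
qed

text \<open>The infimum over the weights is explicit. Write the integrand of the right-hand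
  side as \<open>G w\<close> times \<open>G\<^sup>p\<^sup>-\<^sup>1 d\<^sup>p / w\<close>; the constraint on \<open>w\<close> says precisely that the second factor has
  norm at most 1 in the dual space, so Hoelder's inequality bounds the integral by the cost of \<open>w\<close>.
  Equality holds when the two factors have proportional powers, and solving for \<open>w\<close> gives a
  multiple of \<open>G powr (p / a - 1) * d powr (p / a)\<close>.\<close>

lemma INF_weights_eq_nn_integral:
  fixes G d :: "'a \<Rightarrow> real"
  assumes a: "1 < a" "1 < b" "1 / a + 1 / b = 1" and p: "1 < p"
    and [measurable]: "G \<in> borel_measurable M" "d \<in> borel_measurable M"
    and G0: "\<And>x. x \<in> space M \<Longrightarrow> 0 \<le> G x" and d0: "\<And>x. x \<in> space M \<Longrightarrow> 0 < d x"
  shows "(INF w \<in> {w. w \<in> borel_measurable M \<and> (\<forall>x\<in>space M. 0 \<le> w x) \<and>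
             (\<integral>\<^sup>+x. ennreal (G x) epowr ((p - 1) * b) * ennreal (w x) epowr (- b)
                * ennreal (d x) epowr (p * b) \<partial>M) \<le> 1}.
           (\<integral>\<^sup>+x. ennreal (G x) epowr a * ennreal (w x) epowr a \<partial>M) epowr (1 / a))
         = (\<integral>\<^sup>+x. ennreal (G x powr p * d x powr p) \<partial>M)"
    (is "(INF w \<in> ?S. ?cost w) = ?N")
proof (rule antisym)
  have pb: "0 < (p - 1) * b" "0 < p * b" using a p by auto
  show "?N \<le> (INF w \<in> ?S. ?cost w)"
  proof (rule INF_greatest)
    fix w assume "w \<in> ?S"
    then have [measurable]: "w \<in> borel_measurable M" and w0: "\<And>x. x \<in> space M \<Longrightarrow> 0 \<le> w x"
      and c: "(\<integral>\<^sup>+x. ennreal (G x) epowr ((p - 1) * b) * ennreal (w x) epowr (- b)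
                * ennreal (d x) epowr (p * b) \<partial>M) \<le> 1"
      by auto
    \<comment> \<open>The constraint integrand, with the conventions at zero written out.\<close>
    define h where "h x = (if w x = 0 then (if G x = 0 then 0 else \<infinity>)
      else ennreal ((G x powr (p - 1) * d x powr p / w x) powr b))" for x
    have h: "ennreal (G x) epowr ((p - 1) * b) * ennreal (w x) epowr (- b) * ennreal (d x) epowr (p * b) = h x"
      if x: "x \<in> space M" for x
    proof (cases "w x = 0")
      case True
      then show ?thesis using G0[OF x] d0[OF x] pb a
        by (auto simp: h_def epowr_of_nonneg epowr_of_pos) (auto simp: epowr_def ennreal_mult_top ennreal_top_mult)
    next
      case False
      then have "0 < w x" using w0[OF x] by simp
      then show ?thesis using G0[OF x] d0[OF x] pb a
        by (simp add: h_def epowr_of_nonneg epowr_of_pos powr_mult powr_divide powr_powr powr_minus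
            divide_inverse inverse_powr mult_ac flip: ennreal_mult')
    qed
    have [measurable]: "h \<in> borel_measurable M" unfolding h_def by measurable
    have c': "(\<integral>\<^sup>+x. h x \<partial>M) \<le> 1"
      using c h by (simp cong: nn_integral_cong)
    \<comment> \<open>Outside a null set a weight vanishes only where \<open>G\<close> does; elsewhere the constraint integrand would be infinite.\<close>
    then have "AE x in M. h x \<noteq> \<infinity>"
      by (intro nn_integral_PInf_AE) (auto simp: top_unique)
    then have good: "AE x in M. w x \<noteq> 0 \<or> G x = 0"
      by eventually_elim (auto simp: h_def split: if_splits)
    define g where "g x = (if w x = 0 then 0 else G x powr (p - 1) * d x powr p / w x)" for x
    have [measurable]: "g \<in> borel_measurable M" unfolding g_def by measurable
    have "?N = (\<integral>\<^sup>+x. ennreal ((G x * w x) * g x) \<partial>M)"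
    proof (rule nn_integral_cong_AE)
      show "AE x in M. ennreal (G x powr p * d x powr p) = ennreal ((G x * w x) * g x)"
        using good AE_space
      proof eventually_elim
        case (elim x)
        have "G x powr p = G x * G x powr (p - 1)"
          using G0[OF elim(2)] p by (cases "G x = 0") (auto simp: powr_diff)
        then show ?case using elim by (auto simp: g_def mult_ac)
      qed
    qed
    also have "\<dots> \<le> ?cost w"
    proof -
      have eq: "(\<integral>\<^sup>+x. ennreal (G x) epowr a * ennreal (w x) epowr a \<partial>M)
          = (\<integral>\<^sup>+x. ennreal ((G x * w x) powr a) \<partial>M)"
        using G0 w0 a by (intro nn_integral_cong) (simp add: epowr_of_nonneg powr_mult flip: ennreal_mult')
      show ?thesis
      proof (cases "(\<integral>\<^sup>+x. ennreal ((G x * w x) powr a) \<partial>M)")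
        case (real A)
        have "(\<integral>\<^sup>+x. ennreal (g x powr b) \<partial>M) \<le> (\<integral>\<^sup>+x. h x \<partial>M)"
          by (intro nn_integral_mono) (auto simp: g_def h_def)
        then have "(\<integral>\<^sup>+x. ennreal (g x powr b) \<partial>M) \<le> ennreal 1" using c' by simp
        then have "(\<integral>\<^sup>+x. ennreal ((G x * w x) * g x) \<partial>M) \<le> ennreal (A powr (1 / a) * 1 powr (1 / b))"
          using a real G0 w0 d0 
          by (intro nn_integral_Holder) (auto simp: g_def)
        then show ?thesis using real a unfolding eq by (simp add: epowr_of_nonneg)
      next
        case top
        then show ?thesis using a unfolding eq by (simp add: epowr_def)
      qed
    qed
    finally show "?N \<le> ?cost w" .
  qed
  show "(INF w \<in> ?S. ?cost w) \<le> ?N"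
  proof (cases ?N)
    case top
    then show ?thesis by simp
  next
    case (real N)
    \<comment> \<open>The scaling factor that makes the constraint an equality; if the integral is zero any positive one will do.\<close>
    define l where "l = (if N = 0 then 1 else N powr (1 / b))"
    have l: "0 < l" using real by (auto simp: l_def)
    define w where "w x = l * (G x powr (p / a - 1) * d x powr (p / a))" for x
    have [measurable]: "w \<in> borel_measurable M" unfolding w_def by measurable
    have w0: "0 \<le> w x" for x using l by (simp add: w_def)
    have e: "(p - 1) * b - b * (p / a - 1) = p" "p * b - b * (p / a) = p" "a * (p / a - 1) + a = p"
    proof -
      have "b / a = b - 1" using a by (simp add: field_simps)
      moreover have "b * (p / a) = p * (b / a)" by simp
      ultimately have "b * (p / a) = p * b - p" by (simp add: right_diff_distrib)
      then show "(p - 1) * b - b * (p / a - 1) = p" "p * b - b * (p / a) = p" by (simp_all add: algebra_simps)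
      show "a * (p / a - 1) + a = p" using a by (simp add: field_simps)
    qed
    have constr: "ennreal (G x) epowr ((p - 1) * b) * ennreal (w x) epowr (- b) * ennreal (d x) epowr (p * b)
        = ennreal (l powr (- b)) * ennreal (G x powr p * d x powr p)" if x: "x \<in> space M" for x
    proof (cases "G x = 0")
      case True
      then show ?thesis using epowr_of_nonneg[OF order.refl pb(1)] by simp
    next
      case False
      then have g: "0 < G x" using G0[OF x] by simp
      have "w x > 0" using l g d0[OF x] by (simp add: w_def)
      then have "ennreal (G x) epowr ((p - 1) * b) * ennreal (w x) epowr (- b) * ennreal (d x) epowr (p * b)
        = ennreal (G x powr ((p - 1) * b) * w x powr (- b) * d x powr (p * b))"
        using g d0[OF x] by (simp add: epowr_of_pos flip: ennreal_mult')
      also have "w x powr (- b) = l powr (- b) * (G x powr (- (b * (p / a - 1))) * d x powr (- (b * (p / a))))"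
        using l g d0[OF x] by (simp add: w_def powr_mult powr_powr mult.commute)
      also have "G x powr ((p - 1) * b) * \<dots> * d x powr (p * b)
        = l powr (- b) * (G x powr ((p - 1) * b - b * (p / a - 1)) * d x powr (p * b - b * (p / a)))"
        by (simp only: diff_conv_add_uminus powr_add mult_ac)
      finally show ?thesis unfolding e by (simp flip: ennreal_mult')
    qed
    have "(\<integral>\<^sup>+x. ennreal (G x) epowr ((p - 1) * b) * ennreal (w x) epowr (- b)
                * ennreal (d x) epowr (p * b) \<partial>M) = ennreal (l powr (- b)) * ?N"
      using constr by (simp add: nn_integral_cmult cong: nn_integral_cong)
    also have "\<dots> = ennreal (l powr (- b) * N)"
      using real by (simp flip: ennreal_mult')
    also have "\<dots> \<le> ennreal 1"
      using real a by (intro ennreal_leI) (simp add: l_def powr_powr powr_minus)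
    finally have "w \<in> ?S" using w0 by simp
    moreover have "?cost w = ?N"
    proof -
      have "(\<integral>\<^sup>+x. ennreal (G x) epowr a * ennreal (w x) epowr a \<partial>M)
          = (\<integral>\<^sup>+x. ennreal (l powr a) * ennreal (G x powr p * d x powr p) \<partial>M)"
      proof (rule nn_integral_cong)
        fix x assume x: "x \<in> space M"
        have "(G x * w x) powr a = l powr a * (G x powr p * d x powr p)"
        proof (cases "G x = 0")
          case False
          then have g: "0 < G x" using G0[OF x] by simp
          then have "(G x * w x) powr a = l powr a * (G x powr (a * (p / a - 1) + a) * d x powr p)"
            unfolding w_def using l d0[OF x] a by (simp add: powr_mult powr_powr powr_add mult_ac)
          then show ?thesis unfolding e .
        qed auto
        then show "ennreal (G x) epowr a * ennreal (w x) epowr a = ennreal (l powr a) * ennreal (G x powr p * d x powr p)"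
          using G0[OF x] w0 a by (simp add: epowr_of_nonneg powr_mult flip: ennreal_mult')
      qed
      also have "\<dots> = ennreal (l powr a * N)"
        using real by (simp add: nn_integral_cmult ennreal_mult')
      finally have "?cost w = ennreal ((l powr a * N) powr (1 / a))"
        using a real by (simp add: epowr_of_nonneg)
      also have "(l powr a * N) powr (1 / a) = l * N powr (1 / a)"
        using a real l by (simp add: powr_mult powr_powr)
      also have "\<dots> = N"
      proof (cases "N = 0")
        case False
        then have "l * N powr (1 / a) = N powr (1 / a + 1 / b)" by (simp add: l_def powr_add)
        then show ?thesis using a real by simp
      qed auto
      finally show ?thesis using real by simp
    qed
    ultimately show ?thesis by (metis (no_types, lifting) INF_lower)
  qed
qed


section \<open>Invariance of area under rotations\<close>

lemma nn_integral_lborel_translate: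
  fixes f :: "'a::euclidean_space \<Rightarrow> ennreal"
  assumes [measurable]: "f \<in> borel_measurable borel"
  shows "(\<integral>\<^sup>+x. f (c + x) \<partial>lborel) = (\<integral>\<^sup>+x. f x \<partial>lborel)"
proof -
  have "(\<integral>\<^sup>+x. f x \<partial>lborel) = (\<integral>\<^sup>+x. f x \<partial>distr lborel borel ((+) c))"
    by (simp add: lborel_distr_plus)
  also have "\<dots> = (\<integral>\<^sup>+x. f (c + x) \<partial>lborel)"
    by (subst nn_integral_distr) auto
  finally show ?thesis ..
qed

lemma nn_integral_lborel_scaleR:
  fixes f :: "'a::euclidean_space \<Rightarrow> ennreal"
  assumes [measurable]: "f \<in> borel_measurable borel" and c: "0 < c"
  shows "(\<integral>\<^sup>+x. f x \<partial>lborel) = ennreal (c ^ DIM('a)) * (\<integral>\<^sup>+x. f (c *\<^sub>R x) \<partial>lborel)"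
  using c by (subst lborel_affine[of c 0])
     (simp_all add: nn_integral_density nn_integral_distr nn_integral_cmult)

lemma borel_measurable_ball [measurable]: "ball (z::'a::metric_space) r \<in> sets borel"
  by simp

lemma emeasure_ball_complex:
  "0 \<le> r \<Longrightarrow> emeasure lborel (ball (z::complex) r) = ennreal (pi * r ^ 2)"
  by (simp add: emeasure_ball unit_ball_vol_2)

text \<open>A translation-invariant measure is determined by its value on one ball, and a rotation
  preserves the unit ball. Concretely, the double integral of \<open>f (c * x)\<close> against the indicator
  of the ball in a second variable \<open>y\<close> is computed in two ways: shifting \<open>x\<close> by \<open>y / c\<close> and then \<open>y\<close> by
  \<open>- c * x\<close> moves the integration of \<open>f\<close> to \<open>y\<close>, and the integral over \<open>x\<close> that remains is again
  the area of a unit ball.\<close>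

lemma nn_integral_lborel_rotate:
  fixes f :: "complex \<Rightarrow> ennreal"
  assumes [measurable]: "f \<in> borel_measurable borel" and c: "norm c = 1"
  shows "(\<integral>\<^sup>+x. f (c * x) \<partial>lborel) = (\<integral>\<^sup>+x. f x \<partial>lborel)"
proof -
  let ?I = "\<lambda>y :: complex. indicator (ball 0 1) y :: ennreal"
  have c0: "c \<noteq> 0" using c by auto
  have ball: "(\<integral>\<^sup>+y. ?I y \<partial>lborel) = ennreal pi"
    by (simp add: emeasure_ball_complex)
  have "(\<integral>\<^sup>+x. f (c * x) \<partial>lborel) * ennreal pi
      = (\<integral>\<^sup>+y. (\<integral>\<^sup>+x. f (c * x) * ?I y \<partial>lborel) \<partial>lborel)"
  proof -
    have "(\<integral>\<^sup>+x. f (c * x) \<partial>lborel) * (\<integral>\<^sup>+y. ?I y \<partial>lborel)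
        = (\<integral>\<^sup>+y. (\<integral>\<^sup>+x. f (c * x) \<partial>lborel) * ?I y \<partial>lborel)"
      by (rule nn_integral_cmult[symmetric]) measurable
    also have "\<dots> = (\<integral>\<^sup>+y. (\<integral>\<^sup>+x. f (c * x) * ?I y \<partial>lborel) \<partial>lborel)"
      by (intro nn_integral_cong nn_integral_multc[symmetric]) measurable
    finally show ?thesis by (simp only: ball)
  qed
  also have "\<dots> = (\<integral>\<^sup>+y. (\<integral>\<^sup>+x. f (c * x + y) * ?I y \<partial>lborel) \<partial>lborel)"
  proof (rule nn_integral_cong)
    fix y :: complex
    have "(\<integral>\<^sup>+x. f (c * (y / c + x)) * ?I y \<partial>lborel) = (\<integral>\<^sup>+x. f (c * x) * ?I y \<partial>lborel)"
      by (rule nn_integral_lborel_translate) measurable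
    then show "(\<integral>\<^sup>+x. f (c * x) * ?I y \<partial>lborel) = (\<integral>\<^sup>+x. f (c * x + y) * ?I y \<partial>lborel)"
      using c0 by (simp add: distrib_left add.commute)
  qed
  also have "\<dots> = (\<integral>\<^sup>+x. (\<integral>\<^sup>+y. f (c * x + y) * ?I y \<partial>lborel) \<partial>lborel)"
    by (rule lborel_pair.Fubini') measurable
  also have "\<dots> = (\<integral>\<^sup>+x. (\<integral>\<^sup>+y. f y * ?I (y - c * x) \<partial>lborel) \<partial>lborel)"
  proof (rule nn_integral_cong)
    fix x :: complex
    have "(\<integral>\<^sup>+y. f (c * x + y) * ?I (c * x + y - c * x) \<partial>lborel) = (\<integral>\<^sup>+y. f y * ?I (y - c * x) \<partial>lborel)"
      by (rule nn_integral_lborel_translate) measurable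
    then show "(\<integral>\<^sup>+y. f (c * x + y) * ?I y \<partial>lborel) = (\<integral>\<^sup>+y. f y * ?I (y - c * x) \<partial>lborel)"
      by simp
  qed
  also have "\<dots> = (\<integral>\<^sup>+y. (\<integral>\<^sup>+x. f y * ?I (y - c * x) \<partial>lborel) \<partial>lborel)"
    by (rule lborel_pair.Fubini'[symmetric]) measurable
  also have "\<dots> = (\<integral>\<^sup>+y. f y * ennreal pi \<partial>lborel)"
  proof (rule nn_integral_cong)
    fix y :: complex
    have "?I (y - c * x) = indicator (ball (y / c) 1) x" for x
    proof -
      have "norm (y - c * x) = norm (c * (y / c - x))" using c0 by (simp add: right_diff_distrib)
      then have "norm (y - c * x) = norm (y / c - x)" using c by (simp add: norm_mult)
      then show ?thesis by (simp add: indicator_def dist_norm norm_minus_commute)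
    qed
    then have "(\<integral>\<^sup>+x. f y * ?I (y - c * x) \<partial>lborel) = f y * (\<integral>\<^sup>+x. indicator (ball (y / c) 1) x \<partial>lborel)"
      by (simp only: nn_integral_cmult borel_measurable_indicator measurable_lborel1 sets_lborel borel_open open_ball)
    then show "(\<integral>\<^sup>+x. f y * ?I (y - c * x) \<partial>lborel) = f y * ennreal pi"
      by (simp add: emeasure_ball_complex)
  qed
  also have "\<dots> = (\<integral>\<^sup>+y. f y \<partial>lborel) * ennreal pi"
    by (simp add: nn_integral_multc)
  finally show ?thesis
    using pi_gt_zero unfolding mult_right_ennreal_cancel by linarith
qed

section \<open>Sub-mean value inequalities\<close>

definition circ :: "real \<Rightarrow> complex" where
  "circ t = exp (2 * of_real pi * \<i> * of_real t)"

lemma norm_circ [simp]: "norm (circ t) = 1"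
  by (simp add: circ_def norm_exp_eq_Re)

lemma continuous_on_circ [continuous_intros]: "continuous_on S circ"
  unfolding circ_def by (intro continuous_intros)

lemma borel_measurable_circ [measurable]: "circ \<in> borel_measurable borel"
  by (rule borel_measurable_continuous_onI) (rule continuous_on_circ)

text \<open>The Cauchy formula for the derivative on the unit circle, in absolute value.\<close>

lemma norm_deriv_le_circle_mean:
  assumes H: "H holomorphic_on S" "open S" "cball 0 1 \<subseteq> S"
  shows "ennreal (norm (deriv H 0)) \<le> (\<integral>\<^sup>+t. ennreal (norm (H (circ t))) * indicator {0..1} t \<partial>lborel)"
proof -
  let ?h = "\<lambda>t. H (circ t) / (circ t)\<^sup>2 * (2 * pi * \<i> * circ t)"
  have contH: "continuous_on S H" using H by (simp add: holomorphic_on_imp_continuous_on)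
  have cont: "continuous_on {0..1} (\<lambda>t. H (circ t))"
    by (rule continuous_on_compose2[OF contH continuous_on_circ]) (use H in auto)
  have "((\<lambda>u. H u / (u - 0) ^ Suc 1) has_contour_integral (2 * pi * \<i> / fact 1 * (deriv ^^ 1) H 0)) (circlepath 0 1)"
    using H contH
    by (intro Cauchy_has_contour_integral_higher_derivative_circlepath)
       (auto intro: continuous_on_subset holomorphic_on_subset[OF _ order.trans[OF ball_subset_cball]])
  then have "((\<lambda>u. H u / u\<^sup>2) has_contour_integral (2 * pi * \<i> * deriv H 0)) (circlepath 0 1)"
    by (simp add: numeral_2_eq_2)
  then have "((\<lambda>t. H (circlepath 0 1 t) / (circlepath 0 1 t)\<^sup>2
      * vector_derivative (circlepath 0 1) (at t within {0..1})) has_integral (2 * pi * \<i> * deriv H 0)) {0..1}"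
    by (simp add: has_contour_integral_def)
  then have hi: "(?h has_integral (2 * pi * \<i> * deriv H 0)) {0..1}"
    by (rule has_integral_eq[rotated]) (simp add: vector_derivative_circlepath01, simp add: circlepath circ_def)
  have nh: "norm (?h t) = 2 * pi * norm (H (circ t))" for t
    by (simp add: norm_mult norm_divide norm_power)
  have ci: "(\<lambda>t. norm (H (circ t))) integrable_on {0..1}"
    by (intro integrable_continuous_interval continuous_intros cont)
  have "norm (integral {0..1} ?h) \<le> integral {0..1} (\<lambda>t. 2 * pi * norm (H (circ t)))"
  proof (rule integral_norm_bound_integral)
    show "?h integrable_on {0..1}" using hi by blast
    show "(\<lambda>t. 2 * pi * norm (H (circ t))) integrable_on {0..1}" 
      by (intro integrable_continuous_interval continuous_intros cont)
    show "norm (?h t) \<le> 2 * pi * norm (H (circ t))" for t by (rule eq_refl[OF nh])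
  qed
  then have "norm (deriv H 0) \<le> integral {0..1} (\<lambda>t. norm (H (circ t)))"
    using integral_unique[OF hi] by (simp add: norm_mult)
  then have "ennreal (norm (deriv H 0)) \<le> ennreal (integral {0..1} (\<lambda>t. norm (H (circ t))))"
    by (rule ennreal_leI)
  also have "\<dots> = (\<integral>\<^sup>+t. ennreal (norm (H (circ t))) * indicator {0..1} t \<partial>lborel)"
    using ci by (intro nn_integral_has_integral_lebesgue'[symmetric]) auto
  finally show ?thesis .
qed

lemma norm_deriv_powr_le_circle_mean:
  assumes H: "H holomorphic_on S" "open S" "cball 0 1 \<subseteq> S" and p: "1 < p"
  shows "ennreal (norm (deriv H 0) powr p)
    \<le> (\<integral>\<^sup>+t. ennreal (norm (H (circ t)) powr p) * indicator {0..1} t \<partial>lborel)"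
proof -
  have contH: "continuous_on S H" using H by (simp add: holomorphic_on_imp_continuous_on)
  have cont: "continuous_on UNIV (\<lambda>t. H (circ t))"
    by (rule continuous_on_compose2[OF contH continuous_on_circ]) (use H in auto)
  have [measurable]: "(\<lambda>t. H (circ t)) \<in> borel_measurable borel"
    by (rule borel_measurable_continuous_onI[OF cont])
  have "ennreal (norm (deriv H 0) powr p)
      \<le> ennreal (1 powr (p - 1)) * (\<integral>\<^sup>+t. ennreal ((norm (H (circ t)) * indicator {0..1} t) powr p) \<partial>lborel)"
  proof (rule powr_le_nn_integral_Holder[where g = "indicator {0..1}"])
    have "(\<integral>\<^sup>+x. ennreal (indicator {0..1::real} x powr (p / (p - 1))) \<partial>lborel) = (\<integral>\<^sup>+x. indicator {0..1::real} x \<partial>lborel)"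
      by (intro nn_integral_cong) (auto simp: indicator_def)
    then show "(\<integral>\<^sup>+x. ennreal (indicator {0..1::real} x powr (p / (p - 1))) \<partial>lborel) \<le> ennreal 1"
      by simp
    have "(\<integral>\<^sup>+x. ennreal (norm (H (circ x)) * indicator {0..1} x * indicator {0..1} x) \<partial>lborel)
      = (\<integral>\<^sup>+t. ennreal (norm (H (circ t))) * indicator {0..1} t \<partial>lborel)"
      by (intro nn_integral_cong) (auto simp: indicator_def)
    then show "ennreal (norm (deriv H 0)) \<le> (\<integral>\<^sup>+x. ennreal (norm (H (circ x)) * indicator {0..1} x * indicator {0..1} x) \<partial>lborel)"
      using norm_deriv_le_circle_mean[OF H] by simp
  qed (use p in auto)
  also have "\<dots> = (\<integral>\<^sup>+t. ennreal (norm (H (circ t)) powr p) * indicator {0..1} t \<partial>lborel)"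
    by (simp, intro nn_integral_cong) (auto simp: indicator_def)
  finally show ?thesis .
qed

text \<open>A holomorphic function is controlled only inside its domain; extended by zero it becomes a Borel
  function on the plane, which is what Fubini's theorem and the changes of variables need.\<close>

lemma borel_measurable_extend_zero:
  fixes G :: "'a::topological_space \<Rightarrow> 'b::real_normed_vector"
  assumes "continuous_on S G" "open S"
  shows "(\<lambda>z. if z \<in> S then G z else 0) \<in> borel_measurable borel"
  using borel_measurable_continuous_on_indicator[OF borel_open[OF assms(2)] assms(1)]
  by (rule measurable_cong[THEN iffD1, rotated]) (simp add: indicator_def)

text \<open>Polar coordinates are replaced by averaging over rotations. For fixed \<open>w\<close> with \<open>norm w < r\<close> the Cauchy
  estimate for \<open>u \<mapsto> G (z + w * u)\<close> bounds \<open>norm (deriv G z * w) powr p\<close> by the mean of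
  \<open>norm G powr p\<close> over the circle of radius \<open>norm w\<close>. Integrating over \<open>w\<close> and exchanging the
  integrals leaves, for every angle, the integral over a rotated disc, which is the integral over
  the disc itself.\<close>

lemma norm_deriv_powr_le_disc_mean:
  assumes G: "G holomorphic_on ball z r" and r: "0 < r" and p: "1 < p"
  shows "ennreal (norm (deriv G z) powr p * ((r / 2) powr p * (3 / 4 * pi * r\<^sup>2)))
    \<le> (\<integral>\<^sup>+w. ennreal (norm (G w) powr p) * indicator (ball z r) w \<partial>lborel)"
proof -
  define g where "g w = (if w \<in> ball z r then G w else 0)" for w
  have [measurable]: "g \<in> borel_measurable borel"
    unfolding g_def using G by (intro borel_measurable_extend_zero) (auto simp: holomorphic_on_imp_continuous_on)
  define k where "k w = ennreal (norm (g (z + w)) powr p)" for w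
  have [measurable]: "k \<in> borel_measurable borel" unfolding k_def by measurable
  \<comment> \<open>On this annulus \<open>norm w\<close> is at least \<open>r / 2\<close>, and it has three quarters of the area of the disc.\<close>
  define A where "A = ball 0 r - ball (0::complex) (r / 2)"
  have [measurable]: "A \<in> sets borel" unfolding A_def by auto
  have emA: "emeasure lborel A = ennreal (3 / 4 * pi * r\<^sup>2)"
  proof -
    have "emeasure lborel A = emeasure lborel (ball (0::complex) r) - emeasure lborel (ball (0::complex) (r / 2))"
      unfolding A_def using r by (intro emeasure_Diff) (auto simp: emeasure_ball_complex)
    also have "\<dots> = ennreal (pi * r\<^sup>2 - pi * (r / 2)\<^sup>2)"
      using r by (subst (1 2) emeasure_ball_complex) (auto simp: ennreal_minus)
    finally show ?thesis by (simp add: power2_eq_square field_simps)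
  qed
  have circle: "ennreal (norm (deriv G z) powr p * (r / 2) powr p) * indicator A w
      \<le> (\<integral>\<^sup>+t. k (circ t * w) * indicator {0..1} t \<partial>lborel)" for w
  proof (cases "w \<in> A")
    case True
    then have w: "r / 2 \<le> norm w" "norm w < r" "w \<noteq> 0" using r by (auto simp: A_def)
    define S where "S = (\<lambda>u. z + w * u) -` ball z r"
    define H where "H u = G (z + w * u)" for u
    have S: "open S" unfolding S_def by (intro open_vimage continuous_intros) auto
    have sub: "cball 0 1 \<subseteq> S"
    proof
      fix u :: complex assume "u \<in> cball 0 1"
      then have "norm w * norm u \<le> norm w * 1" by (intro mult_left_mono) auto
      with w have "norm w * norm u < r" by linarith
      then show "u \<in> S" by (simp add: S_def dist_norm norm_mult)
    qed
    have "(G \<circ> (\<lambda>u. z + w * u)) holomorphic_on S"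
      by (intro holomorphic_on_compose_gen[OF _ G] holomorphic_intros) (auto simp: S_def)
    then have hol: "H holomorphic_on S" by (simp add: H_def[abs_def] o_def)
    have "(G has_field_derivative deriv G z) (at z)"
      using G r by (intro holomorphic_derivI) auto
    then have "(G has_field_derivative deriv G z) (at (z + w * 0))" by simp
    then have "(H has_field_derivative (deriv G z * w)) (at 0)"
      unfolding H_def by (rule DERIV_chain2) (auto intro!: derivative_eq_intros)
    then have dH: "deriv H 0 = deriv G z * w" by (rule DERIV_imp_deriv)
    have "ennreal (norm (deriv G z) powr p * (r / 2) powr p) \<le> ennreal (norm (deriv H 0) powr p)"
      unfolding dH using w r p by (intro ennreal_leI) (simp add: norm_mult powr_mult mult_left_mono powr_mono2)
    also have "\<dots> \<le> (\<integral>\<^sup>+t. ennreal (norm (H (circ t)) powr p) * indicator {0..1} t \<partial>lborel)"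
      by (rule norm_deriv_powr_le_circle_mean[OF hol S sub p])
    also have "\<dots> = (\<integral>\<^sup>+t. k (circ t * w) * indicator {0..1} t \<partial>lborel)"
      using w by (intro nn_integral_cong) (simp add: H_def k_def g_def dist_norm norm_mult mult.commute)
    finally show ?thesis using True by simp
  qed simp
  have "ennreal (norm (deriv G z) powr p * ((r / 2) powr p * (3 / 4 * pi * r\<^sup>2)))
      = (\<integral>\<^sup>+w. ennreal (norm (deriv G z) powr p * (r / 2) powr p) * indicator A w \<partial>lborel)"
    using r by (simp add: nn_integral_cmult emA mult.assoc flip: ennreal_mult')
  also have "\<dots> \<le> (\<integral>\<^sup>+w. (\<integral>\<^sup>+t. k (circ t * w) * indicator {0..1} t \<partial>lborel) \<partial>lborel)"
    by (intro nn_integral_mono circle)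
  also have "\<dots> = (\<integral>\<^sup>+t. (\<integral>\<^sup>+w. k (circ t * w) * indicator {0..1} t \<partial>lborel) \<partial>lborel)"
    by (rule lborel_pair.Fubini'[symmetric]) measurable
  also have "\<dots> = (\<integral>\<^sup>+t. (\<integral>\<^sup>+w. k w \<partial>lborel) * indicator {0..1::real} t \<partial>lborel)"
    by (intro nn_integral_cong) (simp add: nn_integral_multc nn_integral_lborel_rotate)
  also have "\<dots> = (\<integral>\<^sup>+w. k w \<partial>lborel)"
    by (simp add: nn_integral_cmult)
  also have "\<dots> = (\<integral>\<^sup>+w. ennreal (norm (g w) powr p) \<partial>lborel)"
    unfolding k_def by (rule nn_integral_lborel_translate) measurable
  also have "\<dots> = (\<integral>\<^sup>+w. ennreal (norm (G w) powr p) * indicator (ball z r) w \<partial>lborel)"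
    by (intro nn_integral_cong) (auto simp: g_def indicator_def)
  finally show ?thesis .
qed

text \<open>The estimate for derivatives, applied to \<open>G w = (w - z) / r * g w\<close>: its derivative at \<open>z\<close> is
  \<open>g z / r\<close>, and it is dominated by \<open>g\<close> on the disc.\<close>

lemma norm_powr_le_disc_mean:
  assumes g: "g holomorphic_on ball z r" and r: "0 < r" and p: "1 < p"
  shows "ennreal (norm (g z) powr p * ((1 / 2) powr p * (3 / 4 * pi * r\<^sup>2)))
    \<le> (\<integral>\<^sup>+w. ennreal (norm (g w) powr p) * indicator (ball z r) w \<partial>lborel)"
proof -
  define G where "G w = (w - z) / of_real r * g w" for w
  have hol: "G holomorphic_on ball z r" unfolding G_def using r by (intro holomorphic_intros g) auto
  have "(g has_field_derivative deriv g z) (at z)"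
    using g r by (intro holomorphic_derivI) auto
  then have "(G has_field_derivative g z / r) (at z)"
    unfolding G_def using r by (auto intro!: derivative_eq_intros)
  then have d: "deriv G z = g z / r" by (rule DERIV_imp_deriv)
  have "(norm (g z) / r) powr p * (r / 2) powr p = norm (g z) powr p * (1 / 2) powr p"
    using r by (simp add: powr_divide)
  then have "ennreal (norm (g z) powr p * ((1 / 2) powr p * (3 / 4 * pi * r\<^sup>2)))
      = ennreal (norm (deriv G z) powr p * ((r / 2) powr p * (3 / 4 * pi * r\<^sup>2)))"
    using r by (simp add: d norm_divide flip: mult.assoc)
  also have "\<dots> \<le> (\<integral>\<^sup>+w. ennreal (norm (G w) powr p) * indicator (ball z r) w \<partial>lborel)"
    by (rule norm_deriv_powr_le_disc_mean[OF hol r p])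
  also have "\<dots> \<le> (\<integral>\<^sup>+w. ennreal (norm (g w) powr p) * indicator (ball z r) w \<partial>lborel)"
  proof (intro nn_integral_mono)
    fix w
    have "norm (G w) \<le> 1 * norm (g w)" if "w \<in> ball z r"
      unfolding G_def norm_mult using that r
      by (intro mult_right_mono) (auto simp: norm_divide dist_norm norm_minus_commute)
    then show "ennreal (norm (G w) powr p) * indicator (ball z r) w
        \<le> ennreal (norm (g w) powr p) * indicator (ball z r) w"
      using p by (auto simp: indicator_def intro!: ennreal_leI powr_mono2)
  qed
  finally show ?thesis .
qed


section \<open>The weighted derivative is bounded by the function\<close>

text \<open>The local estimate on the disc about \<open>z\<close> of radius \<open>r = (1 - norm z) / 2\<close>, integrated over \<open>z\<close>.
  On that disc \<open>1 - norm w\<close> is comparable to \<open>1 - norm z\<close>, so after exchanging the integrals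
  each \<open>w\<close> is counted with the factor \<open>(1 - norm w)\<^sup>-\<^sup>2\<close> over points \<open>z\<close> in a disc of radius \<open>1 - norm w\<close>,
  a bounded amount in total.\<close>

lemma bergman_derivative_upper:
  fixes p :: real
  assumes F: "F holomorphic_on ball 0 1" and p: "1 < p"
  shows "(\<integral>\<^sup>+z. ennreal (norm (deriv F z) powr p * (1 - norm z) powr p) * indicator (ball 0 1) z \<partial>lborel)
    \<le> ennreal (12 * 4 powr p) * (\<integral>\<^sup>+z. ennreal (norm (F z) powr p) * indicator (ball 0 1) z \<partial>lborel)"
proof -
  define f where "f z = (if z \<in> ball 0 1 then F z else 0)" for z
  have [measurable]: "f \<in> borel_measurable borel"
    unfolding f_def using F by (intro borel_measurable_extend_zero) (auto simp: holomorphic_on_imp_continuous_on)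
  define K where "K = 4 powr p * (4 / (3 * pi))"
  have K: "0 < K" by (simp add: K_def)
  \<comment> \<open>The kernel dominating the local estimate: \<open>dist w z < r\<close> forces \<open>dist w z < 1 - norm w\<close> and \<open>1 - norm w \<le> 3 * r\<close>.\<close>
  define k where "k z w = (if dist w z < 1 - norm w then ennreal (K * 9 / (1 - norm w)\<^sup>2 * norm (f w) powr p) else 0)"
    for z w
  have [measurable]: "case_prod k \<in> borel_measurable (lborel \<Otimes>\<^sub>M lborel)" unfolding k_def by measurable
  have pw: "ennreal (norm (deriv F z) powr p * (1 - norm z) powr p) * indicator (ball 0 1) z
      \<le> (\<integral>\<^sup>+w. k z w \<partial>lborel)" for z
  proof (cases "z \<in> ball 0 1")
    case True
    define r where "r = (1 - norm z) / 2"
    have r: "0 < r" using True by (simp add: r_def)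
    have sub: "ball z r \<subseteq> ball 0 1"
    proof
      fix w assume "w \<in> ball z r"
      moreover have "norm w \<le> norm z + dist z w"
        by (metis dist_commute dist_norm norm_triangle_sub)
      ultimately show "w \<in> ball 0 1" using True by (auto simp: r_def)
    qed
    have "(1 - norm z) powr p = 4 powr p * (r / 2) powr p"
    proof -
      have "1 - norm z = 4 * (r / 2)" by (simp add: r_def)
      then show ?thesis using r by (simp only: powr_mult)
    qed
    then have "norm (deriv F z) powr p * (1 - norm z) powr p
        = (K / r\<^sup>2) * (norm (deriv F z) powr p * ((r / 2) powr p * (3 / 4 * pi * r\<^sup>2)))"
      using r by (simp add: K_def)
    then have "ennreal (norm (deriv F z) powr p * (1 - norm z) powr p)
        = ennreal (K / r\<^sup>2) * ennreal (norm (deriv F z) powr p * ((r / 2) powr p * (3 / 4 * pi * r\<^sup>2)))"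
      using K by (subst ennreal_mult'[symmetric]) auto
    also have "\<dots> \<le> ennreal (K / r\<^sup>2) * (\<integral>\<^sup>+w. ennreal (norm (F w) powr p) * indicator (ball z r) w \<partial>lborel)"
      using holomorphic_on_subset[OF F sub] r p by (intro mult_left_mono norm_deriv_powr_le_disc_mean) auto
    also have "\<dots> = ennreal (K / r\<^sup>2) * (\<integral>\<^sup>+w. ennreal (norm (f w) powr p) * indicator (ball z r) w \<partial>lborel)"
    proof -
      have "F w = f w" if "w \<in> ball z r" for w
        using sub that by (auto simp: f_def simp del: mem_ball)
      then have "(\<integral>\<^sup>+w. ennreal (norm (F w) powr p) * indicator (ball z r) w \<partial>lborel)
          = (\<integral>\<^sup>+w. ennreal (norm (f w) powr p) * indicator (ball z r) w \<partial>lborel)"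
        by (intro nn_integral_cong) (simp add: indicator_def del: mem_ball)
      then show ?thesis by simp
    qed
    also have "\<dots> = (\<integral>\<^sup>+w. ennreal (K / r\<^sup>2) * (ennreal (norm (f w) powr p) * indicator (ball z r) w) \<partial>lborel)"
      by (rule nn_integral_cmult[symmetric]) measurable
    also have "\<dots> \<le> (\<integral>\<^sup>+w. k z w \<partial>lborel)"
    proof (rule nn_integral_mono)
      fix w
      show "ennreal (K / r\<^sup>2) * (ennreal (norm (f w) powr p) * indicator (ball z r) w) \<le> k z w"
      proof (cases "w \<in> ball z r")
        case w: True
        have 1: "norm z \<le> norm w + dist w z" "norm w \<le> norm z + dist w z"
          by (metis dist_commute dist_norm norm_triangle_sub)+
        have 2: "dist w z < r" using w by (simp add: dist_commute)
        have d: "dist w z < 1 - norm w" using 1 2 by (simp add: r_def)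
        have "1 - norm w \<le> 3 * r" using 1 2 by (simp add: r_def)
        moreover have w1: "0 < 1 - norm w" using d by (smt (verit) zero_le_dist)
        ultimately have "(1 - norm w)\<^sup>2 \<le> (3 * r)\<^sup>2" by (intro power_mono) auto
        then have "K / r\<^sup>2 \<le> K * 9 / (1 - norm w)\<^sup>2"
          using K r w1 by (simp add: field_simps power_mult_distrib)
        then have "K / r\<^sup>2 * norm (f w) powr p \<le> K * 9 / (1 - norm w)\<^sup>2 * norm (f w) powr p"
          by (rule mult_right_mono) simp
        then show ?thesis using w d K by (simp add: k_def ennreal_leI flip: ennreal_mult')
      qed simp
    qed
    finally show ?thesis using True by simp
  qed simp
  have "(\<integral>\<^sup>+z. ennreal (norm (deriv F z) powr p * (1 - norm z) powr p) * indicator (ball 0 1) z \<partial>lborel)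
      \<le> (\<integral>\<^sup>+z. (\<integral>\<^sup>+w. k z w \<partial>lborel) \<partial>lborel)"
    by (intro nn_integral_mono pw)
  also have "\<dots> = (\<integral>\<^sup>+w. (\<integral>\<^sup>+z. k z w \<partial>lborel) \<partial>lborel)"
    by (rule lborel_pair.Fubini'[symmetric]) measurable
  also have "\<dots> = (\<integral>\<^sup>+w. ennreal (12 * 4 powr p) * (ennreal (norm (F w) powr p) * indicator (ball 0 1) w) \<partial>lborel)"
  proof (rule nn_integral_cong)
    fix w
    show "(\<integral>\<^sup>+z. k z w \<partial>lborel) = ennreal (12 * 4 powr p) * (ennreal (norm (F w) powr p) * indicator (ball 0 1) w)"
    proof (cases "w \<in> ball 0 1")
      case True
      have "(\<integral>\<^sup>+z. k z w \<partial>lborel)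
          = (\<integral>\<^sup>+z. ennreal (K * 9 / (1 - norm w)\<^sup>2 * norm (F w) powr p) * indicator (ball w (1 - norm w)) z \<partial>lborel)"
        using True by (intro nn_integral_cong) (auto simp: k_def f_def indicator_def)
      also have "\<dots> = ennreal (K * 9 / (1 - norm w)\<^sup>2 * norm (F w) powr p) * ennreal (pi * (1 - norm w)\<^sup>2)"
        using True by (simp add: nn_integral_cmult emeasure_ball_complex)
      also have "\<dots> = ennreal (12 * 4 powr p * norm (F w) powr p)"
        using True K by (simp add: K_def flip: ennreal_mult')
      finally show ?thesis using True by (simp flip: ennreal_mult')
    next
      case False
      then have "k z w = 0" for z by (auto simp: k_def f_def)
      then show ?thesis using False by simp
    qed
  qed
  also have "\<dots> = ennreal (12 * 4 powr p) * (\<integral>\<^sup>+z. ennreal (norm (F z) powr p) * indicator (ball 0 1) z \<partial>lborel)"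
  proof (rule nn_integral_cmult)
    have "(\<lambda>w. ennreal (norm (f w) powr p) * indicator (ball 0 1) w) \<in> borel_measurable lborel" by measurable
    then show "(\<lambda>w. ennreal (norm (F w) powr p) * indicator (ball 0 1) w) \<in> borel_measurable lborel"
      by (rule measurable_cong[THEN iffD1, rotated]) (simp add: f_def indicator_def)
  qed
  finally show ?thesis .
qed

section \<open>The function is bounded by its weighted derivative\<close>

lemma nn_integral_inverse_sqrt:
  fixes a b :: real
  assumes "a \<le> b"
  shows "(\<integral>\<^sup>+t. ennreal ((t - a) powr (- 1 / 2)) * indicator {a..b} t \<partial>lborel) = ennreal (2 * (b - a) powr (1 / 2))"
proof (rule nn_integral_has_integral_lebesgue')
  have "((\<lambda>t. (t - a) powr (- 1 / 2)) has_integral 2 * (b - a) powr (1 / 2) - 2 * (a - a) powr (1 / 2)) {a..b}"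
    using assms
  proof (rule fundamental_theorem_of_calculus_interior)
    show "continuous_on {a..b} (\<lambda>t. 2 * (t - a) powr (1 / 2))"
      by (intro continuous_intros continuous_on_powr') auto
    fix x assume "x \<in> {a<..<b}"
    then show "((\<lambda>t. 2 * (t - a) powr (1 / 2)) has_vector_derivative (x - a) powr (- 1 / 2)) (at x)"
      by (auto intro!: derivative_eq_intros simp flip: has_real_derivative_iff_has_vector_derivative)
  qed
  then show "((\<lambda>t. (t - a) powr (- 1 / 2)) has_integral 2 * (b - a) powr (1 / 2)) {a..b}" by simp
qed auto

lemma nn_integral_powr_neg_le:
  fixes a b c e :: real
  assumes "a \<le> b" "b < c" "0 < e"
  shows "(\<integral>\<^sup>+t. ennreal ((c - t) powr (- e - 1)) * indicator {a..b} t \<partial>lborel) \<le> ennreal ((c - b) powr (- e) / e)"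
proof -
  have "((\<lambda>t. (c - t) powr (- e - 1)) has_integral (c - b) powr (- e) / e - (c - a) powr (- e) / e) {a..b}"
  proof (rule fundamental_theorem_of_calculus)
    fix x assume "x \<in> {a..b}"
    then show "((\<lambda>t. (c - t) powr (- e) / e) has_vector_derivative (c - x) powr (- e - 1)) (at x within {a..b})"
      using assms
      by (auto intro!: derivative_eq_intros simp: diff_divide_distrib
          simp flip: has_real_derivative_iff_has_vector_derivative)
  qed (use assms in auto)
  then have "(\<integral>\<^sup>+t. ennreal ((c - t) powr (- e - 1)) * indicator {a..b} t \<partial>lborel)
      = ennreal ((c - b) powr (- e) / e - (c - a) powr (- e) / e)"
    by (intro nn_integral_has_integral_lebesgue') auto
  also have "\<dots> \<le> ennreal ((c - b) powr (- e) / e)"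
    using assms by (intro ennreal_leI) simp
  finally show ?thesis .
qed

lemma of_real_mult_in_disc:
  fixes z :: complex
  assumes "z \<in> ball 0 1" "t \<in> {1/2..1}"
  shows "of_real t * z \<in> ball 0 1"
proof -
  have "t * norm z \<le> 1 * norm z" using assms by (intro mult_right_mono) auto
  then show ?thesis using assms by (simp add: norm_mult)
qed

text \<open>Only the outer half of the radius is used. The change of variables \<open>u = t z\<close> in the area integral
  then costs a bounded factor, whereas integrating from the origin would produce a
  singularity \<open>1 / norm u\<close>.\<close>

lemma norm_radial_difference_le:
  assumes F: "F holomorphic_on ball 0 1" and z: "z \<in> ball 0 1"
  shows "ennreal (norm (F z - F (z / 2)))
    \<le> (\<integral>\<^sup>+t. ennreal (norm (deriv F (of_real t * z))) * indicator {1/2..1} t \<partial>lborel)"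
proof -
  note tz = of_real_mult_in_disc[OF z]
  have hi: "((\<lambda>t. deriv F (of_real t * z) * z) has_integral F (of_real 1 * z) - F (of_real (1/2) * z)) {1/2..1}"
  proof (rule fundamental_theorem_of_calculus)
    fix t :: real assume t: "t \<in> {1/2..1}"
    have "(F has_field_derivative deriv F (of_real t * z)) (at (of_real t * z))"
      using F tz[OF t] by (intro holomorphic_derivI) auto
    moreover have "((\<lambda>t. of_real t * z) has_vector_derivative z) (at t within {1/2..1})"
      by (auto intro!: derivative_eq_intros has_vector_derivative_mult_left)
    ultimately show "((\<lambda>t. F (of_real t * z)) has_vector_derivative deriv F (of_real t * z) * z) (at t within {1/2..1})"
      using field_vector_diff_chain_within[of "\<lambda>t. of_real t * z" z t "{1/2..1}" F, OF _ has_field_derivative_at_within]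
      by (simp add: o_def mult.commute[of z])
  qed auto
  have cont: "continuous_on {1/2..1} (\<lambda>t. deriv F (of_real t * z))"
  proof (rule continuous_on_compose2[of "ball 0 1" "deriv F"])
    show "continuous_on (ball 0 1) (deriv F)"
      using F by (intro holomorphic_on_imp_continuous_on holomorphic_deriv) auto
  qed (use tz in \<open>auto intro!: continuous_intros\<close>)
  have "norm (integral {1/2..1} (\<lambda>t. deriv F (of_real t * z) * z)) \<le> integral {1/2..1} (\<lambda>t. norm (deriv F (of_real t * z)))"
  proof (rule integral_norm_bound_integral)
    show "(\<lambda>t. norm (deriv F (of_real t * z))) integrable_on {1/2..1}"
      by (intro integrable_continuous_interval continuous_intros cont)
    fix t :: real
    show "norm (deriv F (of_real t * z) * z) \<le> norm (deriv F (of_real t * z))"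
      using z by (simp add: norm_mult mult_left_le)
  qed (use hi in blast)
  then have "ennreal (norm (F z - F (z / 2))) \<le> ennreal (integral {1/2..1} (\<lambda>t. norm (deriv F (of_real t * z))))"
    using integral_unique[OF hi] by (intro ennreal_leI) (simp add: mult.commute)
  also have "\<dots> = (\<integral>\<^sup>+t. ennreal (norm (deriv F (of_real t * z))) * indicator {1/2..1} t \<partial>lborel)"
    by (intro nn_integral_has_integral_lebesgue'[symmetric] integrable_integral
        integrable_continuous_interval continuous_intros cont) auto
  finally show ?thesis .
qed


text \<open>Pointwise half of a Hardy inequality. Taking norms under the radial integral gives a
  logarithmically divergent bound, so Hoelder's inequality is applied with a power of \<open>s t = 2 - norm z - t\<close> as weight.
  This weight lies between multiples of \<open>1 - t * norm z\<close>, and a primitive in \<open>t\<close> is at hand for its powers.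
  The exponent is chosen so that the factor \<open>(1 - norm z) powr (- 1 / 2)\<close> which it produces
  is still integrable up to the boundary.\<close>

lemma radial_difference_powr_le:
  fixes p :: real
  assumes F: "F holomorphic_on ball 0 1" and p: "1 < p" and z: "z \<in> ball 0 1"
  shows "ennreal (norm (F z - F (z / 2)) powr p)
    \<le> ennreal ((2 * (p - 1)) powr (p - 1) * 2 powr (p - 1 / 2) * (1 - norm z) powr (- 1 / 2)) *
       (\<integral>\<^sup>+t. ennreal (norm (deriv F (of_real t * z)) powr p * (1 - norm (of_real t * z)) powr (p - 1 / 2))
          * indicator {1/2..1} t \<partial>lborel)"
proof -
  note tz = of_real_mult_in_disc[OF z]
  define f where "f z = (if z \<in> ball 0 1 then deriv F z else 0)" for z
  have [measurable]: "f \<in> borel_measurable borel"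
    unfolding f_def using F
    by (intro borel_measurable_extend_zero holomorphic_on_imp_continuous_on holomorphic_deriv) auto
  define s where "s t = 2 - norm z - t" for t
  have [measurable]: "s \<in> borel_measurable borel" unfolding s_def by measurable
  have s: "0 < s t" "s t \<le> 2 * (1 - norm (of_real t * z))" if "t \<in> {1/2..1}" for t
  proof -
    have "t * norm z \<le> 1 * norm z" using that by (intro mult_right_mono) auto
    moreover have "t * norm z \<le> t * 1" using that z by (intro mult_left_mono) auto
    ultimately have "norm z + t \<ge> 2 * (t * norm z)" by linarith
    then show "s t \<le> 2 * (1 - norm (of_real t * z))"
      using that by (simp add: s_def norm_mult)
    show "0 < s t" using that z by (auto simp: s_def)
  qed
  \<comment> \<open>The weight integral is of order \<open>(1 - norm z) powr (- e)\<close>, and \<open>e * (p - 1) = 1 / 2\<close>.\<close>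
  define e where "e = 1 / (2 * (p - 1))"
  have e: "0 < e" using p by (simp add: e_def)
  define a where "a = (p - 1 / 2) / p"
  define B where "B = (1 - norm z) powr (- e) / e"
  have B: "0 < B" using e z by (simp add: B_def)
  let ?f = "\<lambda>t. norm (f (of_real t * z)) * s t powr a * indicator {1/2..1} t"
  let ?g = "\<lambda>t. s t powr (- a) * indicator {1/2..1} t"
  have "ennreal (norm (F z - F (z / 2)) powr p)
      \<le> ennreal (B powr (p - 1)) * (\<integral>\<^sup>+t. ennreal (?f t powr p) \<partial>lborel)"
  proof (rule powr_le_nn_integral_Holder[where g = ?g, OF p])
    have "(\<integral>\<^sup>+t. ennreal (?g t powr (p / (p - 1))) \<partial>lborel)
        = (\<integral>\<^sup>+t. ennreal ((2 - norm z - t) powr (- e - 1)) * indicator {1/2..1} t \<partial>lborel)"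
    proof (rule nn_integral_cong)
      fix t
      have "- a * (p / (p - 1)) = - e - 1" using p by (simp add: a_def e_def field_simps)
      then show "ennreal (?g t powr (p / (p - 1))) = ennreal ((2 - norm z - t) powr (- e - 1)) * indicator {1/2..1} t"
        by (simp only: s_def[symmetric]) (simp add: powr_powr indicator_def)
    qed
    also have "\<dots> \<le> ennreal ((2 - norm z - 1) powr (- e) / e)"
      using z e by (intro nn_integral_powr_neg_le) auto
    finally show "(\<integral>\<^sup>+t. ennreal (?g t powr (p / (p - 1))) \<partial>lborel) \<le> ennreal B"
      by (simp add: B_def)
    have "ennreal (norm (F z - F (z / 2)))
        \<le> (\<integral>\<^sup>+t. ennreal (norm (deriv F (of_real t * z))) * indicator {1/2..1} t \<partial>lborel)"
      by (rule norm_radial_difference_le[OF F z])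
    also have "\<dots> = (\<integral>\<^sup>+t. ennreal (?f t * ?g t) \<partial>lborel)"
    proof (rule nn_integral_cong)
      fix t
      show "ennreal (norm (deriv F (of_real t * z))) * indicator {1/2..1} t = ennreal (?f t * ?g t)"
        using tz[of t] s(1)[of t] by (auto simp: indicator_def f_def powr_minus)
    qed
    finally show "ennreal (norm (F z - F (z / 2))) \<le> (\<integral>\<^sup>+t. ennreal (?f t * ?g t) \<partial>lborel)" .
  qed (use B in auto)
  also have "\<dots> \<le> ennreal (B powr (p - 1)) * (\<integral>\<^sup>+t. ennreal (2 powr (p - 1 / 2)) *
      (ennreal (norm (f (of_real t * z)) powr p * (1 - norm (of_real t * z)) powr (p - 1 / 2))
          * indicator {1/2..1} t) \<partial>lborel)"
  proof (intro mult_left_mono nn_integral_mono)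
    fix t
    show "ennreal (?f t powr p) \<le> ennreal (2 powr (p - 1 / 2)) *
      (ennreal (norm (f (of_real t * z)) powr p * (1 - norm (of_real t * z)) powr (p - 1 / 2))
          * indicator {1/2..1} t)"
    proof (cases "t \<in> {1/2..1}")
      case True
      have "?f t powr p = norm (f (of_real t * z)) powr p * s t powr (p - 1 / 2)"
        using True p by (simp add: powr_mult powr_powr a_def)
      also have "\<dots> \<le> norm (f (of_real t * z)) powr p * (2 * (1 - norm (of_real t * z))) powr (p - 1 / 2)"
        using s[OF True] p by (intro mult_left_mono powr_mono2) auto
      also have "(2 * (1 - norm (of_real t * z))) powr (p - 1 / 2) = 2 powr (p - 1 / 2) * (1 - norm (of_real t * z)) powr (p - 1 / 2)"
        using tz[OF True] by (intro powr_mult)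
      finally have "?f t powr p \<le> 2 powr (p - 1 / 2) * (norm (f (of_real t * z)) powr p * (1 - norm (of_real t * z)) powr (p - 1 / 2))"
        by (simp only: mult.left_commute)
      then show ?thesis using True by (simp add: ennreal_leI flip: ennreal_mult')
    qed simp
  qed simp
  also have "\<dots> = ennreal (B powr (p - 1)) * (ennreal (2 powr (p - 1 / 2)) * (\<integral>\<^sup>+t.
      (ennreal (norm (f (of_real t * z)) powr p * (1 - norm (of_real t * z)) powr (p - 1 / 2))
          * indicator {1/2..1} t) \<partial>lborel))"
    by (subst nn_integral_cmult) auto
  also have "(\<integral>\<^sup>+t. (ennreal (norm (f (of_real t * z)) powr p * (1 - norm (of_real t * z)) powr (p - 1 / 2))
          * indicator {1/2..1} t) \<partial>lborel)
      = (\<integral>\<^sup>+t. (ennreal (norm (deriv F (of_real t * z)) powr p * (1 - norm (of_real t * z)) powr (p - 1 / 2))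
          * indicator {1/2..1} t) \<partial>lborel)"
    by (intro nn_integral_cong) (use tz in \<open>auto simp: f_def indicator_def\<close>)
  also have "B powr (p - 1) = (2 * (p - 1)) powr (p - 1) * (1 - norm z) powr (- 1 / 2)"
  proof -
    have "B powr (p - 1) = (1 - norm z) powr (- e * (p - 1)) * (1 / e) powr (p - 1)"
      using z e by (simp add: B_def powr_divide powr_powr)
    also have "- e * (p - 1) = - 1 / 2" using p by (simp add: e_def)
    finally show ?thesis by (simp add: e_def)
  qed
  finally show ?thesis
    by (simp add: ennreal_mult' mult_ac)
qed

text \<open>The other half: the pointwise bound is integrated over \<open>z\<close>. After substituting \<open>u = t z\<close> the factor
  \<open>(1 - norm z) powr (- 1 / 2)\<close> becomes at most \<open>(t - norm u) powr (- 1 / 2)\<close>, whose integral over \<open>t\<close> restores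
  exactly the half power of \<open>1 - norm u\<close> that is missing.\<close>

lemma nn_integral_radial_difference_le:
  fixes p :: real
  assumes F: "F holomorphic_on ball 0 1" and p: "1 < p"
  shows "(\<integral>\<^sup>+z. ennreal (norm (F z - F (z / 2)) powr p) * indicator (ball 0 1) z \<partial>lborel)
    \<le> ennreal (8 * (2 * (p - 1)) powr (p - 1) * 2 powr (p - 1 / 2)) *
       (\<integral>\<^sup>+z. ennreal (norm (deriv F z) powr p * (1 - norm z) powr p) * indicator (ball 0 1) z \<partial>lborel)"
proof -
  define f where "f z = (if z \<in> ball 0 1 then deriv F z else 0)" for z
  have [measurable]: "f \<in> borel_measurable borel"
    unfolding f_def using F
    by (intro borel_measurable_extend_zero holomorphic_on_imp_continuous_on holomorphic_deriv) auto
  define C where "C = (2 * (p - 1)) powr (p - 1) * 2 powr (p - 1 / 2)"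
  have C: "0 \<le> C" by (simp add: C_def)
  define k where "k u = ennreal (norm (f u) powr p * (1 - norm u) powr (p - 1 / 2))" for u
  have [measurable]: "k \<in> borel_measurable borel" unfolding k_def by measurable
  define v where "v z = ennreal ((1 - norm z) powr (- 1 / 2)) * indicator (ball 0 1) z" for z :: complex
  have [measurable]: "v \<in> borel_measurable borel" unfolding v_def by measurable
  have scale: "(\<integral>\<^sup>+z. v z * k (of_real t * z) \<partial>lborel)
      \<le> 4 * (\<integral>\<^sup>+u. ennreal ((t - norm u) powr (- 1 / 2)) * indicator {norm u..1} t * k u \<partial>lborel)"
    if t: "t \<in> {1/2..1}" for t
  proof -
    have t0: "0 < t" using t by auto
    have "(\<integral>\<^sup>+u. v (u / of_real t) * k u \<partial>lborel)
        = ennreal (t\<^sup>2) * (\<integral>\<^sup>+z. v (t *\<^sub>R z / of_real t) * k (t *\<^sub>R z) \<partial>lborel)"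
      using t0 by (subst nn_integral_lborel_scaleR[where c = t]) auto
    also have "(\<integral>\<^sup>+z. v (t *\<^sub>R z / of_real t) * k (t *\<^sub>R z) \<partial>lborel)
        = (\<integral>\<^sup>+z. v z * k (of_real t * z) \<partial>lborel)"
      using t0 by (simp add: scaleR_conv_of_real)
    finally have "ennreal (1 / t\<^sup>2) * (\<integral>\<^sup>+u. v (u / of_real t) * k u \<partial>lborel)
        = ennreal (1 / t\<^sup>2) * (ennreal (t\<^sup>2) * (\<integral>\<^sup>+z. v z * k (of_real t * z) \<partial>lborel))"
      by simp
    also have "\<dots> = (\<integral>\<^sup>+z. v z * k (of_real t * z) \<partial>lborel)"
      using t0 by (simp add: mult.assoc[symmetric] flip: ennreal_mult')
    finally have "(\<integral>\<^sup>+z. v z * k (of_real t * z) \<partial>lborel)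
        = ennreal (1 / t\<^sup>2) * (\<integral>\<^sup>+u. v (u / of_real t) * k u \<partial>lborel)" by simp
    also have "\<dots> \<le> ennreal 4 * (\<integral>\<^sup>+u. ennreal ((t - norm u) powr (- 1 / 2)) * indicator {norm u..1} t * k u \<partial>lborel)"
    proof (rule mult_mono)
      have "(1 / 2)\<^sup>2 \<le> t\<^sup>2" using t by (intro power_mono) auto
      then show "ennreal (1 / t\<^sup>2) \<le> ennreal 4"
        using t0 by (intro ennreal_leI) (simp add: field_simps power2_eq_square)
    next
      show "(\<integral>\<^sup>+u. v (u / of_real t) * k u \<partial>lborel)
          \<le> (\<integral>\<^sup>+u. ennreal ((t - norm u) powr (- 1 / 2)) * indicator {norm u..1} t * k u \<partial>lborel)"
      proof (rule nn_integral_mono)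
        fix u :: complex
        have "v (u / of_real t) \<le> ennreal ((t - norm u) powr (- 1 / 2)) * indicator {norm u..1} t"
        proof (cases "norm u < t")
          case True
          have "t * (1 - norm u / t) \<le> 1 * (1 - norm u / t)"
            using t True t0 by (intro mult_right_mono) auto
          moreover have "t * (1 - norm u / t) = t - norm u" using t0 by (simp add: right_diff_distrib)
          ultimately have "t - norm u \<le> 1 - norm u / t" by simp
          then have "(1 - norm u / t) powr (- 1 / 2) \<le> (t - norm u) powr (- 1 / 2)"
            using True by (intro powr_mono2') auto
          then show ?thesis using True t t0 by (simp add: v_def norm_divide ennreal_leI)
        next
          case False
          then have "u / of_real t \<notin> ball 0 1" using t0 by (simp add: norm_divide field_simps)
          then show ?thesis by (simp add: v_def)
        qed
        then show "v (u / of_real t) * k u \<le> ennreal ((t - norm u) powr (- 1 / 2)) * indicator {norm u..1} t * k u"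
          by (rule mult_right_mono) simp
      qed
    qed auto
    finally show ?thesis by simp
  qed
  have "(\<integral>\<^sup>+z. ennreal (norm (F z - F (z / 2)) powr p) * indicator (ball 0 1) z \<partial>lborel)
      \<le> (\<integral>\<^sup>+z. ennreal C * (\<integral>\<^sup>+t. v z * k (of_real t * z) * indicator {1/2..1} t \<partial>lborel) \<partial>lborel)"
  proof (rule nn_integral_mono)
    fix z :: complex
    show "ennreal (norm (F z - F (z / 2)) powr p) * indicator (ball 0 1) z
      \<le> ennreal C * (\<integral>\<^sup>+t. v z * k (of_real t * z) * indicator {1/2..1} t \<partial>lborel)"
    proof (cases "z \<in> ball 0 1")
      case True
      note tz = of_real_mult_in_disc[OF True]
      have "ennreal (norm (F z - F (z / 2)) powr p) \<le> ennreal (C * (1 - norm z) powr (- 1 / 2)) *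
         (\<integral>\<^sup>+t. ennreal (norm (deriv F (of_real t * z)) powr p * (1 - norm (of_real t * z)) powr (p - 1 / 2))
            * indicator {1/2..1} t \<partial>lborel)"
        unfolding C_def by (rule radial_difference_powr_le[OF F p True])
      also have "(\<integral>\<^sup>+t. ennreal (norm (deriv F (of_real t * z)) powr p * (1 - norm (of_real t * z)) powr (p - 1 / 2))
            * indicator {1/2..1} t \<partial>lborel) = (\<integral>\<^sup>+t. k (of_real t * z) * indicator {1/2..1} t \<partial>lborel)"
        by (intro nn_integral_cong) (use tz in \<open>auto simp: k_def f_def indicator_def\<close>)
      also have "ennreal (C * (1 - norm z) powr (- 1 / 2)) * \<dots>
          = ennreal C * (v z * (\<integral>\<^sup>+t. k (of_real t * z) * indicator {1/2..1} t \<partial>lborel))"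
        using True C by (simp add: v_def ennreal_mult' mult.assoc)
      also have "v z * (\<integral>\<^sup>+t. k (of_real t * z) * indicator {1/2..1} t \<partial>lborel)
          = (\<integral>\<^sup>+t. v z * (k (of_real t * z) * indicator {1/2..1} t) \<partial>lborel)"
        by (rule nn_integral_cmult[symmetric]) measurable
      finally show ?thesis using True by (simp add: mult.assoc)
    qed simp
  qed
  also have "\<dots> = ennreal C * (\<integral>\<^sup>+z. (\<integral>\<^sup>+t. v z * k (of_real t * z) * indicator {1/2..1} t \<partial>lborel) \<partial>lborel)"
    by (rule nn_integral_cmult) measurable
  finally have pointwise: "(\<integral>\<^sup>+z. ennreal (norm (F z - F (z / 2)) powr p) * indicator (ball 0 1) z \<partial>lborel)
      \<le> ennreal C * (\<integral>\<^sup>+z. (\<integral>\<^sup>+t. v z * k (of_real t * z) * indicator {1/2..1} t \<partial>lborel) \<partial>lborel)" .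
  have "(\<integral>\<^sup>+z. (\<integral>\<^sup>+t. v z * k (of_real t * z) * indicator {1/2..1} t \<partial>lborel) \<partial>lborel)
      = (\<integral>\<^sup>+t. (\<integral>\<^sup>+z. v z * k (of_real t * z) * indicator {1/2..1} t \<partial>lborel) \<partial>lborel)"
    by (rule lborel_pair.Fubini'[symmetric]) measurable
  also have "\<dots> \<le> (\<integral>\<^sup>+t. 4 * (\<integral>\<^sup>+u. ennreal ((t - norm u) powr (- 1 / 2)) * indicator {norm u..1} t * k u \<partial>lborel) \<partial>lborel)"
  proof (rule nn_integral_mono)
    fix t :: real
    have "(\<integral>\<^sup>+z. v z * k (of_real t * z) * indicator {1/2..1} t \<partial>lborel)
        = (\<integral>\<^sup>+z. v z * k (of_real t * z) \<partial>lborel) * indicator {1/2..1} t"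
      by (rule nn_integral_multc) measurable
    then show "(\<integral>\<^sup>+z. v z * k (of_real t * z) * indicator {1/2..1} t \<partial>lborel)
      \<le> 4 * (\<integral>\<^sup>+u. ennreal ((t - norm u) powr (- 1 / 2)) * indicator {norm u..1} t * k u \<partial>lborel)"
      using scale[of t] by (cases "t \<in> {1/2..1}") (auto simp: indicator_def)
  qed
  also have "\<dots> = 4 * (\<integral>\<^sup>+t. (\<integral>\<^sup>+u. ennreal ((t - norm u) powr (- 1 / 2)) * indicator {norm u..1} t * k u \<partial>lborel) \<partial>lborel)"
    unfolding indicator_def atLeastAtMost_iff by (rule nn_integral_cmult) measurable
  also have "(\<integral>\<^sup>+t. (\<integral>\<^sup>+u. ennreal ((t - norm u) powr (- 1 / 2)) * indicator {norm u..1} t * k u \<partial>lborel) \<partial>lborel)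
      = (\<integral>\<^sup>+u. (\<integral>\<^sup>+t. ennreal ((t - norm u) powr (- 1 / 2)) * indicator {norm u..1} t * k u \<partial>lborel) \<partial>lborel)"
    unfolding indicator_def atLeastAtMost_iff by (rule lborel_pair.Fubini') measurable
  also have "\<dots> = (\<integral>\<^sup>+u. 2 * (ennreal (norm (deriv F u) powr p * (1 - norm u) powr p) * indicator (ball 0 1) u) \<partial>lborel)"
  proof (rule nn_integral_cong)
    fix u :: complex
    show "(\<integral>\<^sup>+t. ennreal ((t - norm u) powr (- 1 / 2)) * indicator {norm u..1} t * k u \<partial>lborel)
      = 2 * (ennreal (norm (deriv F u) powr p * (1 - norm u) powr p) * indicator (ball 0 1) u)"
    proof (cases "u \<in> ball 0 1")
      case True
      have "(\<integral>\<^sup>+t. ennreal ((t - norm u) powr (- 1 / 2)) * indicator {norm u..1} t * k u \<partial>lborel)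
          = (\<integral>\<^sup>+t. ennreal ((t - norm u) powr (- 1 / 2)) * indicator {norm u..1} t \<partial>lborel) * k u"
        by (rule nn_integral_multc) measurable
      also have "\<dots> = ennreal (2 * (1 - norm u) powr (1 / 2)) * k u"
        using True by (subst nn_integral_inverse_sqrt) auto
      also have "\<dots> = ennreal (2 * (norm (deriv F u) powr p * ((1 - norm u) powr (1 / 2) * (1 - norm u) powr (p - 1 / 2))))"
        using True by (simp add: k_def f_def mult_ac flip: ennreal_mult')
      also have "(1 - norm u) powr (1 / 2) * (1 - norm u) powr (p - 1 / 2) = (1 - norm u) powr p"
        by (simp flip: powr_add)
      finally show ?thesis using True by (simp add: ennreal_mult')
    next
      case False
      then have "k u = 0" by (simp add: k_def f_def)
      then show ?thesis using False by simp
    qed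
  qed
  also have "\<dots> = 2 * (\<integral>\<^sup>+u. ennreal (norm (deriv F u) powr p * (1 - norm u) powr p) * indicator (ball 0 1) u \<partial>lborel)"
  proof (rule nn_integral_cmult)
    have "(\<lambda>u. ennreal (norm (f u) powr p * (1 - norm u) powr p) * indicator (ball 0 1) u) \<in> borel_measurable lborel"
      by measurable
    then show "(\<lambda>u. ennreal (norm (deriv F u) powr p * (1 - norm u) powr p) * indicator (ball 0 1) u) \<in> borel_measurable lborel"
      by (rule measurable_cong[THEN iffD1, rotated]) (simp add: f_def indicator_def)
  qed
  finally have "(\<integral>\<^sup>+z. (\<integral>\<^sup>+t. v z * k (of_real t * z) * indicator {1/2..1} t \<partial>lborel) \<partial>lborel)
      \<le> 4 * (2 * (\<integral>\<^sup>+u. ennreal (norm (deriv F u) powr p * (1 - norm u) powr p) * indicator (ball 0 1) u \<partial>lborel))" .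
  then have "ennreal C * (\<integral>\<^sup>+z. (\<integral>\<^sup>+t. v z * k (of_real t * z) * indicator {1/2..1} t \<partial>lborel) \<partial>lborel)
      \<le> ennreal C * (4 * (2 * (\<integral>\<^sup>+u. ennreal (norm (deriv F u) powr p * (1 - norm u) powr p) * indicator (ball 0 1) u \<partial>lborel)))"
    by (rule mult_left_mono) simp
  also have "ennreal C * (4 * (2 * (\<integral>\<^sup>+u. ennreal (norm (deriv F u) powr p * (1 - norm u) powr p) * indicator (ball 0 1) u \<partial>lborel)))
      = ennreal (8 * C) * (\<integral>\<^sup>+u. ennreal (norm (deriv F u) powr p * (1 - norm u) powr p) * indicator (ball 0 1) u \<partial>lborel)"
  proof -
    have "ennreal (8 * C) = (4 * 2) * ennreal C" using C by (simp add: ennreal_mult')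
    then show ?thesis by (simp only: mult_ac)
  qed
  finally show ?thesis
    using pointwise unfolding C_def mult.assoc by (rule order.trans[rotated])
qed


text \<open>Split \<open>F z\<close> into \<open>F z - F (z / 2)\<close>, which the Hardy inequality controls, and \<open>F (z / 2)\<close>. For the latter,
  the mean value inequality for \<open>deriv F\<close> on discs of radius 1/4 bounds the derivative on the disc of
  radius 1/2, where the weight \<open>1 - norm z\<close> stays away from zero, and \<open>F 0 = 0\<close> turns this into
  a bound for \<open>F (z / 2)\<close>.\<close>

lemma bergman_derivative_lower:
  fixes p :: real
  assumes F: "F holomorphic_on ball 0 1" and F0: "F 0 = 0" and p: "1 < p"
  shows "(\<integral>\<^sup>+z. ennreal (norm (F z) powr p) * indicator (ball 0 1) z \<partial>lborel)
    \<le> ennreal (2 powr p * (8 * (2 * (p - 1)) powr (p - 1) * 2 powr (p - 1 / 2) + 8 powr p * (64 / 3))) *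
       (\<integral>\<^sup>+z. ennreal (norm (deriv F z) powr p * (1 - norm z) powr p) * indicator (ball 0 1) z \<partial>lborel)"
    (is "_ \<le> ennreal (2 powr p * (?C + ?K)) * ?N")
proof (cases ?N)
  case top
  have "0 < 2 powr p * (?C + ?K)" using p by (intro mult_pos_pos add_nonneg_pos) simp_all
  then have "ennreal (2 powr p * (?C + ?K)) \<noteq> 0" by (simp only: ennreal_eq_0_iff not_le)
  with top have "ennreal (2 powr p * (?C + ?K)) * ?N = top" by (simp only: ennreal_mult_top if_False)
  then show ?thesis by (simp only: top_greatest)
next
  case (real N)
  have hF': "deriv F holomorphic_on ball 0 1" using F by (intro holomorphic_deriv) auto
  define c where "c = 8 powr p * (64 / (3 * pi))"
  have c: "0 < c" by (simp add: c_def)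
  have centre: "norm (deriv F w) \<le> (c * N) powr (1 / p)" if w: "norm w \<le> 1 / 2" for w
  proof -
    have sub: "ball w (1 / 4) \<subseteq> ball 0 (3 / 4)"
    proof
      fix u assume "u \<in> ball w (1 / 4)"
      moreover have "norm u \<le> norm w + dist w u"
        by (metis dist_commute dist_norm norm_triangle_sub)
      ultimately show "u \<in> ball 0 (3 / 4)" using w by auto
    qed
    then have sub1: "ball w (1 / 4) \<subseteq> ball 0 1" by (auto simp: subset_iff)
    have "ennreal (norm (deriv F w) powr p * ((1 / 2) powr p * (3 / 4 * pi * (1 / 4)\<^sup>2)))
        \<le> (\<integral>\<^sup>+u. ennreal (norm (deriv F u) powr p) * indicator (ball w (1 / 4)) u \<partial>lborel)"
      using holomorphic_on_subset[OF hF' sub1] p by (intro norm_powr_le_disc_mean) auto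
    also have "\<dots> \<le> (\<integral>\<^sup>+u. ennreal (4 powr p) * (ennreal (norm (deriv F u) powr p * (1 - norm u) powr p) * indicator (ball 0 1) u) \<partial>lborel)"
    proof (rule nn_integral_mono)
      fix u
      show "ennreal (norm (deriv F u) powr p) * indicator (ball w (1 / 4)) u
        \<le> ennreal (4 powr p) * (ennreal (norm (deriv F u) powr p * (1 - norm u) powr p) * indicator (ball 0 1) u)"
      proof (cases "u \<in> ball w (1 / 4)")
        case True
        then have u: "norm u < 3 / 4" using sub by auto
        have "1 \<le> (4 * (1 - norm u)) powr p" using u p by (intro ge_one_powr_ge_zero) auto
        also have "\<dots> = 4 powr p * (1 - norm u) powr p" using u by (intro powr_mult)
        finally have "norm (deriv F u) powr p * 1 \<le> norm (deriv F u) powr p * (4 powr p * (1 - norm u) powr p)"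
          by (rule mult_left_mono) simp
        then show ?thesis using True u by (simp add: mult_ac ennreal_leI flip: ennreal_mult')
      qed simp
    qed
    also have "\<dots> = ennreal (4 powr p) * ?N"
    proof (rule nn_integral_cmult)
      have "continuous_on (ball 0 1) (deriv F)" using hF' by (rule holomorphic_on_imp_continuous_on)
      then have [measurable]: "(\<lambda>u. if u \<in> ball 0 1 then deriv F u else 0) \<in> borel_measurable borel"
        by (intro borel_measurable_extend_zero) auto
      have "(\<lambda>u. ennreal (norm (if u \<in> ball 0 1 then deriv F u else 0) powr p * (1 - norm u) powr p) * indicator (ball 0 1) u) \<in> borel_measurable lborel"
        by measurable
      then show "(\<lambda>u. ennreal (norm (deriv F u) powr p * (1 - norm u) powr p) * indicator (ball 0 1) u) \<in> borel_measurable lborel"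
        by (rule measurable_cong[THEN iffD1, rotated]) (simp add: indicator_def)
    qed
    also have "\<dots> = ennreal (4 powr p * N)"
      using real by (simp add: ennreal_mult')
    finally have "norm (deriv F w) powr p * ((1 / 2) powr p * (3 / 4 * pi * (1 / 4)\<^sup>2)) \<le> 4 powr p * N"
      using real by (simp add: ennreal_le_iff)
    moreover have "8 powr p = 4 powr p * 2 powr p" by (simp flip: powr_mult)
    ultimately have "norm (deriv F w) powr p \<le> c * N"
      by (simp add: c_def powr_divide field_simps power2_eq_square)
    then have "(norm (deriv F w) powr p) powr (1 / p) \<le> (c * N) powr (1 / p)"
      using p by (intro powr_mono2) auto
    then show ?thesis using p by (simp add: powr_powr)
  qed
  have half: "norm (F (z / 2)) powr p \<le> c * N" if z: "z \<in> ball 0 1" for z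
  proof -
    have "norm (F (z / 2) - F 0) \<le> (c * N) powr (1 / p) * norm (z / 2 - 0)"
    proof (rule field_differentiable_bound[of "cball 0 (1 / 2)"])
      fix w :: complex assume w: "w \<in> cball 0 (1 / 2)"
      then show "(F has_field_derivative deriv F w) (at w within cball 0 (1 / 2))"
        using F by (intro has_field_derivative_at_within[OF holomorphic_derivI]) auto
      show "norm (deriv F w) \<le> (c * N) powr (1 / p)" using w by (intro centre) simp
    qed (use z in \<open>auto simp: norm_divide\<close>)
    also have "\<dots> \<le> (c * N) powr (1 / p) * 1"
      using z by (intro mult_left_mono) (auto simp: norm_divide)
    finally have "norm (F (z / 2)) powr p \<le> ((c * N) powr (1 / p)) powr p"
      using F0 p by (intro powr_mono2) auto
    then show ?thesis using p c real by (simp add: powr_powr)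
  qed
  have split: "norm (F z) powr p \<le> 2 powr p * (norm (F z - F (z / 2)) powr p + norm (F (z / 2)) powr p)" for z
  proof -
    let ?a = "norm (F z - F (z / 2))" and ?b = "norm (F (z / 2))"
    have "norm (F z) \<le> ?a + ?b" by (metis diff_add_cancel norm_triangle_ineq)
    then have "norm (F z) \<le> 2 * max ?a ?b" by (auto simp: max_def)
    then have "norm (F z) powr p \<le> (2 * max ?a ?b) powr p" using p by (intro powr_mono2) auto
    also have "\<dots> = 2 powr p * max ?a ?b powr p" by (rule powr_mult)
    also have "\<dots> \<le> 2 powr p * (?a powr p + ?b powr p)"
      by (intro mult_left_mono) (auto simp: max_def)
    finally show ?thesis .
  qed
  have "continuous_on (ball 0 1) (\<lambda>z. F z - F (z / 2))"
  proof (intro continuous_on_diff)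
    show cF: "continuous_on (ball 0 1) F" using F by (rule holomorphic_on_imp_continuous_on)
    show "continuous_on (ball 0 1) (\<lambda>z. F (z / 2))"
      by (rule continuous_on_compose2[OF cF]) (auto intro!: continuous_intros simp: norm_divide)
  qed
  then have [measurable]: "(\<lambda>z. if z \<in> ball 0 1 then F z - F (z / 2) else 0) \<in> borel_measurable borel"
    by (intro borel_measurable_extend_zero) auto
  have "(\<lambda>z. ennreal (norm (if z \<in> ball 0 1 then F z - F (z / 2) else 0) powr p) * indicator (ball 0 1) z) \<in> borel_measurable lborel"
    by measurable
  then have meas [measurable]: "(\<lambda>z. ennreal (norm (F z - F (z / 2)) powr p) * indicator (ball 0 1) z) \<in> borel_measurable lborel"
    by (rule measurable_cong[THEN iffD1, rotated]) (simp add: indicator_def)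
  have "(\<integral>\<^sup>+z. ennreal (norm (F z) powr p) * indicator (ball 0 1) z \<partial>lborel)
      \<le> (\<integral>\<^sup>+z. ennreal (2 powr p) * (ennreal (norm (F z - F (z / 2)) powr p) * indicator (ball 0 1) z
           + ennreal (c * N) * indicator (ball 0 1) z) \<partial>lborel)"
  proof (rule nn_integral_mono)
    fix z
    show "ennreal (norm (F z) powr p) * indicator (ball 0 1) z
      \<le> ennreal (2 powr p) * (ennreal (norm (F z - F (z / 2)) powr p) * indicator (ball 0 1) z
           + ennreal (c * N) * indicator (ball 0 1) z)"
    proof (cases "z \<in> ball 0 1")
      case True
      have "norm (F z) powr p \<le> 2 powr p * (norm (F z - F (z / 2)) powr p + c * N)"
        using split[of z] half[OF True] by (smt (verit) mult_left_mono powr_ge_zero)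
      then show ?thesis using True c real by (simp add: ennreal_leI flip: ennreal_mult' ennreal_plus)
    qed simp
  qed
  also have "\<dots> = ennreal (2 powr p) * (\<integral>\<^sup>+z. ennreal (norm (F z - F (z / 2)) powr p) * indicator (ball 0 1) z
           + ennreal (c * N) * indicator (ball 0 1) z \<partial>lborel)"
    by (rule nn_integral_cmult, rule borel_measurable_add) measurable
  also have "(\<integral>\<^sup>+z. ennreal (norm (F z - F (z / 2)) powr p) * indicator (ball 0 1) z
           + ennreal (c * N) * indicator (ball 0 1) z \<partial>lborel)
      = (\<integral>\<^sup>+z. ennreal (norm (F z - F (z / 2)) powr p) * indicator (ball 0 1) z \<partial>lborel)
        + (\<integral>\<^sup>+z. ennreal (c * N) * indicator (ball (0::complex) 1) z \<partial>lborel)"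
    by (rule nn_integral_add) measurable
  also have "(\<integral>\<^sup>+z. ennreal (c * N) * indicator (ball (0::complex) 1) z \<partial>lborel) = ennreal (?K * N)"
  proof -
    have "(\<integral>\<^sup>+z. ennreal (c * N) * indicator (ball (0::complex) 1) z \<partial>lborel) = ennreal (c * N) * ennreal pi"
      by (subst nn_integral_cmult_indicator) (auto simp: emeasure_ball_complex)
    also have "\<dots> = ennreal (c * N * pi)" using c real by (intro ennreal_mult[symmetric]) auto
    also have "c * N * pi = ?K * N" by (simp add: c_def)
    finally show ?thesis .
  qed
  also have "ennreal (2 powr p) * ((\<integral>\<^sup>+z. ennreal (norm (F z - F (z / 2)) powr p) * indicator (ball 0 1) z \<partial>lborel) + ennreal (?K * N))
      \<le> ennreal (2 powr p) * (ennreal ?C * ?N + ennreal (?K * N))"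
    by (intro mult_left_mono add_right_mono nn_integral_radial_difference_le F p) auto
  also have "\<dots> = ennreal (2 powr p * (?C + ?K)) * ?N"
    using real by (simp add: distrib_left distrib_right mult.assoc flip: ennreal_mult' ennreal_plus)
  finally show ?thesis .
qed

section \<open>The norm as an infimum over weights\<close>

lemma nn_integral_area_disc:
  "(\<integral>\<^sup>+z. f z \<partial>area_disc) = (\<integral>\<^sup>+z. f z * indicator unit_disc z \<partial>lborel)"
  by (simp add: nn_integral_restrict_space nn_integral_completion)

theorem theorem3:
  fixes \<alpha> \<alpha>' p :: real
  assumes "1 < \<alpha>" and "\<alpha> < 2" and "1 / \<alpha> + 1 / \<alpha>' = 1" and "\<alpha>' \<le> p"
  shows "\<exists>c C :: real. 0 < c \<and> c \<le> C \<and>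
    (\<forall>F. F holomorphic_on unit_disc \<and> F 0 = 0 \<longrightarrow>
      (let Y = (INF \<omega> \<in> S2 p \<alpha>' F.
                 (\<integral>\<^sup>+z. ennreal (norm (deriv F z)) epowr \<alpha> * ennreal (\<omega> z) epowr \<alpha> \<partial>area_disc)
                   epowr (1 / \<alpha>))
       in ennreal c * bergman_norm_pow p F \<le> Y \<and> Y \<le> ennreal C * bergman_norm_pow p F))"
proof -
  have "1 / \<alpha> < 1" using assms(1) by simp
  then have "0 < 1 / \<alpha>'" "1 / \<alpha>' < 1" using assms(1,3) by (smt (verit) zero_less_divide_1_iff)+
  then have q: "1 < \<alpha>'" by (simp add: field_simps)
  then have p: "1 < p" using assms(4) by simp
  define L where "L = 2 powr p * (8 * (2 * (p - 1)) powr (p - 1) * 2 powr (p - 1 / 2) + 8 powr p * (64 / 3))"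
  have L: "0 < L" unfolding L_def by (intro mult_pos_pos add_nonneg_pos) auto
  define U where "U = max (12 * 4 powr p) (1 / L)"
  show ?thesis
  proof (rule exI[of _ "1 / L"], rule exI[of _ U], intro conjI allI impI)
    show "0 < 1 / L" "1 / L \<le> U" using L by (auto simp: U_def)
    fix F assume "F holomorphic_on unit_disc \<and> F 0 = 0"
    then have F: "F holomorphic_on unit_disc" "F 0 = 0" by auto
    have "continuous_on unit_disc (deriv F)"
      using F by (intro holomorphic_on_imp_continuous_on holomorphic_deriv) auto
    then have [measurable]: "deriv F \<in> borel_measurable area_disc"
      by (intro continuous_imp_measurable_on_sets_lebesgue) auto
    have [measurable]: "(\<lambda>z. 1 - norm z) \<in> borel_measurable area_disc"
      by (intro continuous_imp_measurable_on_sets_lebesgue continuous_intros) auto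
    define Y where "Y = (INF \<omega> \<in> S2 p \<alpha>' F.
                 (\<integral>\<^sup>+z. ennreal (norm (deriv F z)) epowr \<alpha> * ennreal (\<omega> z) epowr \<alpha> \<partial>area_disc)
                   epowr (1 / \<alpha>))"
    define N where "N = (\<integral>\<^sup>+z. ennreal (norm (deriv F z) powr p * (1 - norm z) powr p) * indicator unit_disc z \<partial>lborel)"
    have "Y = (\<integral>\<^sup>+z. ennreal (norm (deriv F z) powr p * (1 - norm z) powr p) \<partial>area_disc)"
      using INF_weights_eq_nn_integral[of \<alpha> \<alpha>' p "\<lambda>z. norm (deriv F z)" area_disc "\<lambda>z. 1 - norm z"] assms p q
      by (simp add: Y_def S2_def)
    then have Y: "Y = N" by (simp add: N_def nn_integral_area_disc)
    have B: "bergman_norm_pow p F = (\<integral>\<^sup>+z. ennreal (norm (F z) powr p) * indicator unit_disc z \<partial>lborel)"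
      using p by (simp add: bergman_norm_pow_def epowr_of_nonneg nn_integral_area_disc)
    have "ennreal (1 / L) * bergman_norm_pow p F \<le> ennreal (1 / L) * (ennreal L * N)"
      unfolding B N_def L_def by (intro mult_left_mono bergman_derivative_lower F p) auto
    also have "\<dots> = N" using L by (simp add: mult.assoc[symmetric] flip: ennreal_mult')
    finally have lower: "ennreal (1 / L) * bergman_norm_pow p F \<le> Y" by (simp add: Y)
    have "Y \<le> ennreal (12 * 4 powr p) * bergman_norm_pow p F"
      unfolding Y B N_def by (intro bergman_derivative_upper F p)
    also have "\<dots> \<le> ennreal U * bergman_norm_pow p F"
      by (intro mult_right_mono ennreal_leI) (auto simp: U_def)
    finally show "let Y = (INF \<omega> \<in> S2 p \<alpha>' F.
                 (\<integral>\<^sup>+z. ennreal (norm (deriv F z)) epowr \<alpha> * ennreal (\<omega> z) epowr \<alpha> \<partial>area_disc)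
                   epowr (1 / \<alpha>))
       in ennreal (1 / L) * bergman_norm_pow p F \<le> Y \<and> Y \<le> ennreal U * bergman_norm_pow p F"
      using lower by (simp add: Let_def Y_def)
  qed
qed

end
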